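(* Let $E$ be a separable complex Banach space. The following assertions are equivalent: (a) $E$ contains no isomorphic copy of $\mathrm{c}_0$. (b) Every doubly power-bounded operator $T\in\mathscr{L}(E)$ such that the set $\{T^{n+1}x-T^nx \mid n\in\mathbb{N}\}$ is relatively compact in $E$ for every $x\in E$ is almost periodic, i.e., the orbit $\{T^nx\mid n\in\mathbb{N}\}$ is relatively compact in $E$ for every $x\in E$.
   Context: $\mathscr{L}(E)$ denotes the space of bounded linear operators on the Banach space $E$. An operator $T\in\mathscr{L}(E)$ is power-bounded if $\sup_{n\in\mathbb{N}}\|T^n\|<\infty$; it is doubly power-bounded if it is invertible and both $T$ and $T^{-1}$ are power-bounded. $\mathrm{c}_0$ is the Banach space of complex null sequences with the supremum norm; "$E$ contains an isomorphic copy of $\mathrm{c}_0$" means that some closed subspace of $E$ is linearly homeomorphic to $\mathrm{c}_0$. Relative compactness is with respect to the norm topology. *)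

theory Defs
  imports "HOL-Analysis.Analysis"
begin

section \<open>Complex normed spaces\<close>

class complex_normed_vector = real_normed_vector +
  fixes scaleC :: "complex \<Rightarrow> 'a \<Rightarrow> 'a" (infixr \<open>*\<^sub>C\<close> 75)
  assumes scaleC_add_right: "a *\<^sub>C (x + y) = a *\<^sub>C x + a *\<^sub>C y"
    and scaleC_add_left: "(a + b) *\<^sub>C x = a *\<^sub>C x + b *\<^sub>C x"
    and scaleC_scaleC: "a *\<^sub>C b *\<^sub>C x = (a * b) *\<^sub>C x"
    and scaleR_scaleC: "r *\<^sub>R x = complex_of_real r *\<^sub>C x"
    and norm_scaleC: "norm (a *\<^sub>C x) = cmod a * norm x"

lemma scaleC_one: "1 *\<^sub>C x = (x :: 'a::complex_normed_vector)"
  using scaleR_scaleC[of 1 x] by simp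

global_interpretation complex_vector:
  vector_space "scaleC :: complex \<Rightarrow> 'a \<Rightarrow> 'a::complex_normed_vector"
  by unfold_locales
    (simp_all add: scaleC_add_right scaleC_add_left scaleC_scaleC scaleC_one)

lemma bounded_linear_scaleC:
  "bounded_linear (scaleC a :: 'a \<Rightarrow> 'a::complex_normed_vector)"
proof (rule bounded_linear_intro)
  show "norm (a *\<^sub>C x) \<le> norm x * cmod a" for x :: 'a
    by (simp add: norm_scaleC mult.commute)
qed (simp_all add: scaleC_add_right scaleR_scaleC scaleC_scaleC mult.commute)

instantiation complex :: complex_normed_vector
begin

definition scaleC_complex :: "complex \<Rightarrow> complex \<Rightarrow> complex"
  where "scaleC_complex a x = a * x"

instance
  by standard (simp_all add: scaleC_complex_def algebra_simps norm_mult scaleR_conv_of_real)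

end

lemma scaleC_bcontfun_aux:
  fixes f :: "'a::topological_space \<Rightarrow> 'b::complex_normed_vector"
  assumes "f \<in> bcontfun"
  shows "(\<lambda>x. a *\<^sub>C f x) \<in> bcontfun"
proof -
  have "continuous_on UNIV (\<lambda>x. a *\<^sub>C f x)"
    using assms
    by (auto simp: bcontfun_def intro: bounded_linear.continuous_on[OF bounded_linear_scaleC])
  moreover have "bounded ((*\<^sub>C) a ` range f)"
    using assms
    by (intro bounded_linear_image bounded_linear_scaleC) (simp add: bcontfun_def)
  ultimately show ?thesis
    by (simp add: bcontfun_def image_image)
qed

instantiation bcontfun :: (topological_space, complex_normed_vector) complex_normed_vector
begin

definition scaleC_bcontfun :: "complex \<Rightarrow> ('a \<Rightarrow>\<^sub>C 'b) \<Rightarrow> 'a \<Rightarrow>\<^sub>C 'b"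
  where "scaleC_bcontfun a f = Bcontfun (\<lambda>x. a *\<^sub>C apply_bcontfun f x)"

lemma apply_bcontfun_scaleC: "apply_bcontfun (a *\<^sub>C f) = (\<lambda>x. a *\<^sub>C apply_bcontfun f x)"
  unfolding scaleC_bcontfun_def
  by (rule Bcontfun_inverse) (rule scaleC_bcontfun_aux[OF apply_bcontfun])

instance
proof
  fix a b :: complex and r :: real and f g :: "'a \<Rightarrow>\<^sub>C 'b"
  show "a *\<^sub>C (f + g) = a *\<^sub>C f + a *\<^sub>C g"
    by (rule bcontfun_eqI) (simp add: apply_bcontfun_scaleC plus_bcontfun.rep_eq scaleC_add_right)
  show "(a + b) *\<^sub>C f = a *\<^sub>C f + b *\<^sub>C f"
    by (rule bcontfun_eqI) (simp add: apply_bcontfun_scaleC plus_bcontfun.rep_eq scaleC_add_left)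
  show "a *\<^sub>C b *\<^sub>C f = (a * b) *\<^sub>C f"
    by (rule bcontfun_eqI) (simp add: apply_bcontfun_scaleC scaleC_scaleC)
  show "r *\<^sub>R f = complex_of_real r *\<^sub>C f"
    by (rule bcontfun_eqI) (simp add: apply_bcontfun_scaleC scaleR_bcontfun.rep_eq scaleR_scaleC)
  have le: "norm (c *\<^sub>C h) \<le> cmod c * norm h" for c and h :: "'a \<Rightarrow>\<^sub>C 'b"
    by (rule norm_bound)
      (simp add: apply_bcontfun_scaleC norm_scaleC mult_left_mono norm_bounded)
  show "norm (a *\<^sub>C f) = cmod a * norm f"
  proof (cases "a = 0")
    case True
    have "norm (a *\<^sub>C f) \<le> 0"
      using le[of a f] True by simp
    then show ?thesis
      using True by simp
  next
    case False
    have "f = inverse a *\<^sub>C a *\<^sub>C f"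
      using False
      by (intro bcontfun_eqI) (simp add: apply_bcontfun_scaleC scaleC_scaleC scaleC_one)
    then have "norm f \<le> cmod (inverse a) * norm (a *\<^sub>C f)"
      by (metis le)
    then have "cmod a * norm f \<le> norm (a *\<^sub>C f)"
      using False by (simp add: norm_inverse norm_divide field_simps)
    with le[of a f] show ?thesis
      by linarith
  qed
qed

end


section \<open>Isomorphic copies of the space of null sequences\<close>

text \<open>The topology of \<^typ>\<open>nat\<close> is discrete, so \<^typ>\<open>nat \<Rightarrow>\<^sub>C complex\<close> is the space of all bounded
  complex sequences, normed by the supremum.\<close>

definition c0 :: "(nat \<Rightarrow>\<^sub>C complex) set"
  where "c0 = {u. apply_bcontfun u \<longlonglongrightarrow> 0}"

definition linearly_homeomorphic ::
    "'a::complex_normed_vector set \<Rightarrow> 'b::complex_normed_vector set \<Rightarrow> bool"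
  where "linearly_homeomorphic S T \<longleftrightarrow>
    (\<exists>f g. homeomorphism S T f g \<and>
       (\<forall>x\<in>S. \<forall>y\<in>S. f (x + y) = f x + f y) \<and>
       (\<forall>a. \<forall>x\<in>S. f (a *\<^sub>C x) = a *\<^sub>C f x))"

definition contains_copy_of_c0 :: "'a::complex_normed_vector itself \<Rightarrow> bool"
  where "contains_copy_of_c0 _ \<longleftrightarrow>
    (\<exists>F :: 'a set. complex_vector.subspace F \<and> closed F \<and> linearly_homeomorphic F c0)"


section \<open>Operators\<close>

definition bounded_clinear ::
    "('a::complex_normed_vector \<Rightarrow> 'b::complex_normed_vector) \<Rightarrow> bool"
  where "bounded_clinear T \<longleftrightarrow> bounded_linear T \<and> Vector_Spaces.linear scaleC scaleC T"

definition power_bounded :: "('a::complex_normed_vector \<Rightarrow> 'a) \<Rightarrow> bool"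
  where "power_bounded T \<longleftrightarrow> bounded_clinear T \<and> bdd_above (range (\<lambda>n. onorm (T ^^ n)))"

definition doubly_power_bounded :: "('a::complex_normed_vector \<Rightarrow> 'a) \<Rightarrow> bool"
  where "doubly_power_bounded T \<longleftrightarrow>
    power_bounded T \<and> (\<exists>S. power_bounded S \<and> S \<circ> T = id \<and> T \<circ> S = id)"

definition relatively_compact :: "'a::topological_space set \<Rightarrow> bool"
  where "relatively_compact A \<longleftrightarrow> compact (closure A)"

definition almost_periodic :: "('a::complex_normed_vector \<Rightarrow> 'a) \<Rightarrow> bool"
  where "almost_periodic T \<longleftrightarrow> (\<forall>x. relatively_compact (range (\<lambda>n. (T ^^ n) x)))"

end

theory Submission
  imports Defs
begin

text \<open>
  Suppose first that \<open>T\<close> satisfies the hypotheses of (b) but the orbit of some \<open>x\<close> is not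
  relatively compact. Put \<open>d = T x - x\<close> and \<open>z m = T\<^sup>m x - x\<close>. The orbit of \<open>d\<close> is totally
  bounded while that of \<open>x\<close> is not, and powers of \<open>T\<close> distort distances only by a constant
  factor. Comparing two indices at which the orbit of \<open>d\<close> nearly agrees gives powers \<open>p\<close> for
  which \<open>T\<^sup>p d\<close> is as close to \<open>d\<close> as desired while the norm of \<open>z p\<close> stays above a fixed
  \<open>\<delta>\<close> (\<open>return_times\<close>). Since \<open>z m\<close> is the sum of the \<open>T\<^sup>i d\<close> with \<open>i < m\<close>, such a
  \<open>T\<^sup>p\<close> almost fixes \<open>z m\<close>, and the cocycle identity \<open>z (p + m) = T\<^sup>p (z m) + z p\<close> becomes
  almost additive. Choosing \<open>p 0, p 1, ...\<close> successively, each with an accuracy adapted to the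
  sum of the previous ones, makes every finite subset sum of the vectors \<open>z (p k)\<close> equal,
  up to a bounded error, to a single \<open>z N\<close>, and hence bounded.

  A sequence of vectors bounded away from zero whose finite subset sums are bounded generates a
  copy of \<open>c\<^sub>0\<close>, by the argument of Bessaga and Pelczynski. The upper estimate for linear
  combinations comes from testing against functionals; for the lower one, take functionals norming
  the individual vectors and use Rosenthal's disjointness lemma to pass to a subsequence on which
  the interaction of different indices is small (\<open>contains_copy_of_c0_of_bounded_sums\<close>).

  Conversely, suppose that there is a copy of \<open>c\<^sub>0\<close>, with basis \<open>e\<^sub>k\<close> and coordinate
  functionals extended by Hahn--Banach to functionals \<open>\<phi> k\<close> on the whole space with a common norm
  bound. The functionals \<open>\<psi> k = \<phi> k + \<phi> 0\<close> with \<open>k \<ge> 1\<close> are still biorthogonal to the vectors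
  \<open>e\<^sub>k\<close> with \<open>k \<ge> 1\<close>, but take the value \<open>1\<close> at \<open>e\<^sub>0\<close>, so that they do not tend to zero pointwise.
  For unimodular \<open>\<mu>\<^sub>k\<close> tending to \<open>1\<close>, the operator
  \<open>x \<mapsto> x + \<Sum>\<^sub>k (\<mu>\<^sub>k - 1) \<psi>\<^sub>k(x) e\<^sub>k\<close>, summed over \<open>k \<ge> 1\<close>, is well defined, and its powers arise by replacing \<open>\<mu>\<^sub>k\<close>
  by powers of \<open>\<mu>\<^sub>k\<close>. So it is doubly power-bounded, and the coordinates of the differences
  \<open>T\<^bsup>n+1\<^esup> x - T\<^bsup>n\<^esup> x\<close> are dominated by a null sequence independent of \<open>n\<close>. With \<open>\<mu>\<^sub>k\<close> of order
  \<open>2\<^sup>k\<close>, the orbit of \<open>e\<^sub>0\<close> contains an infinite separated set.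
\<close>

section \<open>The Hahn--Banach theorem for real and complex functionals\<close>

text \<open>
  Functionals dominated by \<open>C\<close> times the norm are handled through their graphs, which are
  subspaces of the product with the real line. This makes extension a matter of inclusion, and a
  dominated subspace is automatically single-valued, since \<open>(0, t)\<close> in it forces \<open>t \<le> 0\<close> and
  \<open>-t \<le> 0\<close>. An admissible value \<open>c\<close> at a further vector \<open>a\<close> exists because, by the triangle
  inequality, every lower constraint on \<open>c\<close> lies below every upper one.
\<close>

lemma dominated_graph_extend:
  fixes G :: "('a::real_normed_vector \<times> real) set"
  assumes G: "subspace G" and dom: "\<And>x t. (x, t) \<in> G \<Longrightarrow> t \<le> C * norm x"
    and C: "C \<ge> 0"
  obtains c where "\<And>x t. (x, t) \<in> span (insert (a, c) G) \<Longrightarrow> t \<le> C * norm x"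
proof -
  define L where "L = (\<lambda>(x, t). t - C * norm (x - a)) ` G"
  have LU: "t - C * norm (x - a) \<le> C * norm (y + a) - s" if "(x, t) \<in> G" "(y, s) \<in> G" for x y s t
  proof -
    have "(x + y, t + s) \<in> G"
      using subspace_add[OF G that] by simp
    then have "t + s \<le> C * norm (x + y)"
      by (rule dom)
    also have "\<dots> \<le> C * (norm (x - a) + norm (y + a))"
      using norm_triangle_ineq[of "x - a" "y + a"] C by (simp add: mult_left_mono)
    finally show ?thesis
      by (simp add: algebra_simps)
  qed
  have zero: "(0, 0) \<in> G"
    using subspace_0[OF G] by (simp add: zero_prod_def)
  have L0: "L \<noteq> {}"
    using zero by (auto simp: L_def)
  define c where "c = Sup L"
  have up: "t - C * norm (x - a) \<le> c" if "(x, t) \<in> G" for x t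
    unfolding c_def
    using LU[OF _ zero] that by (intro cSup_upper bdd_aboveI[where M = "C * norm (0 + a) - 0"]) (force simp: L_def)+
  have low: "c \<le> C * norm (y + a) - s" if "(y, s) \<in> G" for y s
    unfolding c_def
    using L0 LU[OF _ that] by (intro cSup_least) (auto simp: L_def)
  have "t \<le> C * norm x" if xt: "(x, t) \<in> span (insert (a, c) G)" for x t
  proof -
    have "span G = G"
      using G by (simp add: span_eq_iff)
    with xt have "\<exists>k. (x, t) - k *\<^sub>R (a, c) \<in> G"
      by (simp only: span_breakdown_eq)
    then obtain k where k: "(x - k *\<^sub>R a, t - k * c) \<in> G"
      by auto
    consider "k = 0" | "k > 0" | "k < 0" by linarith
    then show ?thesis
    proof cases
      case 1
      then show ?thesis
        using dom[OF k] by simp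
    next
      case 2
      have "((1/k) *\<^sub>R (x - k *\<^sub>R a), (1/k) * (t - k * c)) \<in> G"
        using subspace_scale[OF G k, of "1/k"] by simp
      from low[OF this] have "c \<le> C * norm ((1/k) *\<^sub>R x) - (1/k) * (t - k * c)"
        using 2 by (simp add: algebra_simps)
      then have "c \<le> C * (norm x / k) - (t - k * c) / k"
        using 2 by simp
      then show ?thesis
        using 2 by (simp add: field_simps)
    next
      case 3
      have "((-1/k) *\<^sub>R (x - k *\<^sub>R a), (-1/k) * (t - k * c)) \<in> G"
        using subspace_scale[OF G k, of "-1/k"] by simp
      from up[OF this] have "(-1/k) * (t - k * c) - C * norm ((-1/k) *\<^sub>R x) \<le> c"
        using 3 by (simp add: algebra_simps)
      then have "- ((t - k * c) / k) - C * (norm x / (-k)) \<le> c"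
        using 3 by simp
      then show ?thesis
        using 3 by (simp add: field_simps)
    qed
  qed
  then show ?thesis
    by (rule that)
qed

text \<open>
  Zorn's lemma yields a maximal dominated graph; by the one-step extension it is defined everywhere.
\<close>

lemma hahn_banach_graph:
  fixes G0 :: "('a::real_normed_vector \<times> real) set"
  assumes G0: "subspace G0" and dom: "\<And>x t. (x, t) \<in> G0 \<Longrightarrow> t \<le> C * norm x"
    and C: "C \<ge> 0"
  obtains g :: "'a \<Rightarrow> real" where "linear g" "\<And>x. \<bar>g x\<bar> \<le> C * norm x"
    "\<And>x t. (x, t) \<in> G0 \<Longrightarrow> g x = t"
proof -
  define \<A> where "\<A> = {G. subspace G \<and> G0 \<subseteq> G \<and> (\<forall>x t. (x, t) \<in> G \<longrightarrow> t \<le> C * norm x)}"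
  have "\<exists>M\<in>\<A>. \<forall>X\<in>\<A>. M \<subseteq> X \<longrightarrow> X = M"
  proof (rule subset_Zorn_nonempty)
    show "\<A> \<noteq> {}"
      using assms by (auto simp: \<A>_def)
  next
    fix \<C> assume ne: "\<C> \<noteq> {}" and ch: "subset.chain \<A> \<C>"
    have sub: "subspace G" if "G \<in> \<C>" for G
      using ch that by (auto simp: subset.chain_def \<A>_def)
    have "subspace (\<Union>\<C>)"
    proof (rule subspaceI)
      show "0 \<in> \<Union>\<C>"
        using ne sub subspace_0 by blast
    next
      fix u v assume "u \<in> \<Union>\<C>" "v \<in> \<Union>\<C>"
      then obtain X Y where XY: "X \<in> \<C>" "u \<in> X" "Y \<in> \<C>" "v \<in> Y" by blast
      have "X \<subseteq> Y \<or> Y \<subseteq> X"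
        using ch XY by (auto simp: subset.chain_def)
      then show "u + v \<in> \<Union>\<C>"
        using XY sub subspace_add by (metis Union_iff subsetD)
    next
      fix r u assume "u \<in> \<Union>\<C>"
      then show "r *\<^sub>R u \<in> \<Union>\<C>"
        using sub subspace_scale by blast
    qed
    then show "\<Union>\<C> \<in> \<A>"
      using ch ne by (auto simp: subset.chain_def \<A>_def)
  qed
  then obtain G where G: "subspace G" "G0 \<subseteq> G" and domG: "\<And>x t. (x, t) \<in> G \<Longrightarrow> t \<le> C * norm x"
    and max: "\<And>X. X \<in> \<A> \<Longrightarrow> G \<subseteq> X \<Longrightarrow> X = G"
    by (auto simp: \<A>_def)
  have total: "\<exists>t. (a, t) \<in> G" for a
  proof -
    obtain c where c: "\<And>x t. (x, t) \<in> span (insert (a, c) G) \<Longrightarrow> t \<le> C * norm x"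
      using dominated_graph_extend[OF G(1) domG C] by metis
    have sup: "insert (a, c) G \<subseteq> span (insert (a, c) G)"
      by (rule span_superset)
    have "span (insert (a, c) G) \<in> \<A>"
      using c sup G(2) by (auto simp: \<A>_def)
    then have "span (insert (a, c) G) = G"
      using sup by (intro max) auto
    then show ?thesis
      using sup by blast
  qed
  have unique: "t = s" if "(a, t) \<in> G" "(a, s) \<in> G" for a t s
  proof -
    have "(0, t - s) \<in> G" "(0, s - t) \<in> G"
      using subspace_diff[OF G(1) that] subspace_diff[OF G(1) that(2,1)] by simp_all
    then show ?thesis
      using domG[of 0 "t - s"] domG[of 0 "s - t"] by simp
  qed
  define g where "g a = (THE t. (a, t) \<in> G)" for a
  have gG: "(a, g a) \<in> G" for a
    unfolding g_def using total unique by (metis theI)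
  have geq: "g a = t" if "(a, t) \<in> G" for a t
    using gG that unique by blast
  show ?thesis
  proof
    show "linear g"
    proof (rule linearI)
      show "g (u + v) = g u + g v" for u v
        using subspace_add[OF G(1) gG[of u] gG[of v]] by (intro geq) simp
      show "g (r *\<^sub>R u) = r *\<^sub>R g u" for r u
        using subspace_scale[OF G(1) gG[of u], of r] by (intro geq) simp
    qed
    then show "\<bar>g x\<bar> \<le> C * norm x" for x
      using domG[OF gG[of x]] domG[OF gG[of "-x"]] by (simp add: linear_neg abs_le_iff)
    show "g x = t" if "(x, t) \<in> G0" for x t
      using that G(2) by (intro geq) blast
  qed
qed

text \<open>
  The bound is carried as a parameter, because families of functionals with a common bound
  are needed below.
\<close>

definition clinear_functional :: "real \<Rightarrow> ('a::complex_normed_vector \<Rightarrow> complex) \<Rightarrow> bool"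
  where "clinear_functional C \<phi> \<longleftrightarrow> (\<forall>x y. \<phi> (x + y) = \<phi> x + \<phi> y) \<and>
    (\<forall>a x. \<phi> (a *\<^sub>C x) = a * \<phi> x) \<and> (\<forall>x. cmod (\<phi> x) \<le> C * norm x)"

lemma clinear_functionalD:
  assumes "clinear_functional C \<phi>"
  shows "\<phi> (x + y) = \<phi> x + \<phi> y" "\<phi> (a *\<^sub>C x) = a * \<phi> x" "cmod (\<phi> x) \<le> C * norm x"
    "\<phi> (- x) = - \<phi> x" "\<phi> (x - y) = \<phi> x - \<phi> y" "\<phi> 0 = 0" "\<phi> (sum f A) = (\<Sum>i\<in>A. \<phi> (f i))"
proof -
  have add: "\<phi> (x + y) = \<phi> x + \<phi> y" for x y
    using assms by (auto simp: clinear_functional_def)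
  then interpret additive \<phi>
    by (rule additive.intro)
  show "\<phi> (x + y) = \<phi> x + \<phi> y" "\<phi> (a *\<^sub>C x) = a * \<phi> x" "cmod (\<phi> x) \<le> C * norm x"
    "\<phi> (- x) = - \<phi> x" "\<phi> (x - y) = \<phi> x - \<phi> y" "\<phi> 0 = 0" "\<phi> (sum f A) = (\<Sum>i\<in>A. \<phi> (f i))"
    using assms by (auto simp: clinear_functional_def minus diff zero sum)
qed

text \<open>
  A complex functional is determined by its real part through \<open>\<phi> x = g x - i g (i x)\<close>. The bound
  survives since \<open>\<phi> x\<close> can be rotated onto the positive real axis by a scalar of modulus one,
  where it is seen by \<open>g\<close>.
\<close>

lemma complexify_functional:
  fixes g :: "'a::complex_normed_vector \<Rightarrow> real"
  assumes "linear g" and bound: "\<And>x. \<bar>g x\<bar> \<le> C * norm x"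
  obtains \<phi> where "clinear_functional C \<phi>" "\<And>x. Re (\<phi> x) = g x"
proof -
  define \<phi> where "\<phi> x = Complex (g x) (- g (\<i> *\<^sub>C x))" for x
  interpret linear g by fact
  have add: "\<phi> (x + y) = \<phi> x + \<phi> y" for x y
    by (simp add: \<phi>_def scaleC_add_right add complex_eq_iff)
  have ii: "\<phi> (\<i> *\<^sub>C x) = \<i> * \<phi> x" for x
    by (simp add: \<phi>_def scaleC_scaleC complex_eq_iff scaleC_one neg)
  have re: "\<phi> (complex_of_real r *\<^sub>C x) = r * \<phi> x" for r x
  proof -
    have "\<i> *\<^sub>C complex_of_real r *\<^sub>C x = r *\<^sub>R (\<i> *\<^sub>C x)"
      by (simp add: scaleR_scaleC scaleC_scaleC mult.commute)
    then show ?thesis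
      by (simp add: \<phi>_def complex_eq_iff scale flip: scaleR_scaleC)
  qed
  have sc: "\<phi> (a *\<^sub>C x) = a * \<phi> x" for a x
  proof -
    have "a *\<^sub>C x = complex_of_real (Re a) *\<^sub>C x + \<i> *\<^sub>C complex_of_real (Im a) *\<^sub>C x"
      by (simp only: scaleC_scaleC scaleC_add_left[symmetric] complex_eq[symmetric])
    then have "\<phi> (a *\<^sub>C x) = Re a * \<phi> x + \<i> * (Im a * \<phi> x)"
      by (simp only: add ii re)
    also have "\<dots> = a * \<phi> x"
      by (simp add: complex_eq_iff)
    finally show ?thesis .
  qed
  have "cmod (\<phi> x) \<le> C * norm x" for x
  proof -
    \<comment> \<open>The rotation; when \<open>\<phi> x = 0\<close> it is \<open>0\<close> instead of a scalar of modulus one.\<close>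
    define s where "s = cnj (sgn (\<phi> x))"
    have "cnj (\<phi> x) * \<phi> x = cmod (\<phi> x) * cmod (\<phi> x)"
      by (metis complex_norm_square mult.commute of_real_power power2_eq_square of_real_mult)
    then have "s * \<phi> x = cmod (\<phi> x)"
      by (simp add: s_def sgn_eq)
    then have "cmod (\<phi> x) = Re (\<phi> (s *\<^sub>C x))"
      by (simp add: sc)
    also have "\<dots> \<le> C * norm (s *\<^sub>C x)"
      using bound[of "s *\<^sub>C x"] by (simp add: \<phi>_def)
    also have "\<dots> \<le> C * norm x"
    proof -
      have "cmod s \<le> 1"
        by (simp add: s_def norm_sgn)
      then have "cmod s * (C * norm x) \<le> 1 * (C * norm x)"
        using bound[of x] by (intro mult_right_mono) auto
      then show ?thesis
        by (simp add: norm_scaleC mult.commute mult.left_commute)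
    qed
    finally show ?thesis .
  qed
  then have "clinear_functional C \<phi>"
    by (simp add: clinear_functional_def add sc)
  then show ?thesis
    by (rule that) (simp add: \<phi>_def)
qed

lemma hahn_banach_complex:
  fixes f :: "'a::complex_normed_vector \<Rightarrow> complex"
  assumes S: "complex_vector.subspace S"
    and add: "\<And>x y. x \<in> S \<Longrightarrow> y \<in> S \<Longrightarrow> f (x + y) = f x + f y"
    and sc: "\<And>a x. x \<in> S \<Longrightarrow> f (a *\<^sub>C x) = a * f x"
    and bound: "\<And>x. x \<in> S \<Longrightarrow> cmod (f x) \<le> C * norm x"
    and C: "C \<ge> 0"
  obtains \<phi> where "clinear_functional C \<phi>" "\<And>x. x \<in> S \<Longrightarrow> \<phi> x = f x"
proof -
  define G where "G = (\<lambda>x. (x, Re (f x))) ` S"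
  have S': "x + y \<in> S" "a *\<^sub>C x \<in> S" "r *\<^sub>R x \<in> S" "0 \<in> S" if "x \<in> S" "y \<in> S" for x y a r
    using S that by (auto simp: complex_vector.subspace_def scaleR_scaleC)
  have f0: "f 0 = 0"
    using sc[of 0 0] S by (auto simp: complex_vector.subspace_def)
  have "subspace G"
  proof (rule subspaceI)
    show "0 \<in> G"
      using f0 complex_vector.subspace_0[OF S] by (force simp: G_def zero_prod_def)
    show "u + v \<in> G" if "u \<in> G" "v \<in> G" for u v
    proof -
      obtain x y where "x \<in> S" "y \<in> S" "u = (x, Re (f x))" "v = (y, Re (f y))"
        using \<open>u \<in> G\<close> \<open>v \<in> G\<close> unfolding G_def by blast
      then show ?thesis
        unfolding G_def by (intro image_eqI[of _ _ "x + y"]) (simp_all add: add S'(1))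
    qed
    show "r *\<^sub>R u \<in> G" if "u \<in> G" for r u
    proof -
      obtain x where x: "x \<in> S" "u = (x, Re (f x))"
        using \<open>u \<in> G\<close> unfolding G_def by blast
      have "Re (f (r *\<^sub>R x)) = r * Re (f x)"
        using sc[OF x(1), of r] by (simp add: scaleR_scaleC)
      then show ?thesis
        using x S'(3)[OF x(1) x(1)] unfolding G_def by (intro image_eqI[of _ _ "r *\<^sub>R x"]) simp_all
    qed
  qed
  moreover have "t \<le> C * norm x" if "(x, t) \<in> G" for x t
    using that bound[of x] complex_Re_le_cmod[of "f x"] by (force simp: G_def)
  ultimately obtain g where g: "linear g" "\<And>x. \<bar>g x\<bar> \<le> C * norm x"
    "\<And>x t. (x, t) \<in> G \<Longrightarrow> g x = t"
    using hahn_banach_graph[of G C] C by metis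
  from complexify_functional[OF g(1,2)] obtain \<phi> where
    \<phi>: "clinear_functional C \<phi>" "\<And>x. Re (\<phi> x) = g x" by metis
  have Re: "Re (\<phi> x) = Re (f x)" if "x \<in> S" for x
    using that unfolding \<phi>(2) by (intro g(3)) (simp add: G_def)
  have "\<phi> x = f x" if "x \<in> S" for x
  proof -
    have "Re (\<i> * \<phi> x) = Re (\<i> * f x)"
      using Re[OF S'(2)[OF that that, of \<i>]] that
      by (simp only: clinear_functionalD(2)[OF \<phi>(1)] sc)
    then show ?thesis
      using Re[OF that] by (simp add: complex_eq_iff)
  qed
  with \<phi>(1) show ?thesis
    by (rule that)
qed

text \<open>
  Here the graph formulation pays off: the graph to be extended is the real line through
  \<open>(v, norm v)\<close>, which covers \<open>v = 0\<close> as well. The imaginary part of \<open>\<phi> v\<close> vanishes because the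
  real part already exhausts the bound on the modulus.
\<close>

lemma norming_functional:
  fixes v :: "'a::complex_normed_vector"
  obtains \<phi> where "clinear_functional 1 \<phi>" "\<phi> v = norm v"
proof -
  have "subspace (span {(v, norm v)})" by simp
  moreover have "t \<le> 1 * norm x" if "(x, t) \<in> span {(v, norm v)}" for x t
    using that by (auto simp: span_singleton intro!: mult_right_mono)
  ultimately obtain g where g: "linear g" "\<And>x. \<bar>g x\<bar> \<le> 1 * norm x"
    "\<And>x t. (x, t) \<in> span {(v, norm v)} \<Longrightarrow> g x = t"
    using hahn_banach_graph[of "span {(v, norm v)}" 1] by (metis zero_le_one)
  from complexify_functional[OF g(1,2)] obtain \<phi> where
    \<phi>: "clinear_functional 1 \<phi>" "\<And>x. Re (\<phi> x) = g x" by metis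
  have Re: "Re (\<phi> v) = norm v"
    using g(3) by (simp add: \<phi>(2) span_base)
  moreover have "cmod (\<phi> v) \<le> norm v"
    using clinear_functionalD(3)[OF \<phi>(1), of v] by simp
  ultimately have "Im (\<phi> v) = 0"
    using power_mono[of "cmod (\<phi> v)" "norm v" 2] by (simp add: cmod_power2)
  then have "\<phi> v = norm v"
    using Re by (simp add: complex_eq_iff)
  with \<phi>(1) show ?thesis
    by (rule that)
qed

section \<open>Series with bounded subset sums and copies of the null sequences\<close>

text \<open>
  A sequence is continuous for the discrete topology, so a null sequence is the underlying
  function of an element of \<^const>\<open>c0\<close>.
\<close>

lemma null_sequence_bcontfun:
  fixes a :: "nat \<Rightarrow> complex"
  assumes "a \<longlonglongrightarrow> 0"
  shows apply_Bcontfun_null: "apply_bcontfun (Bcontfun a) = a" and Bcontfun_null_in_c0: "Bcontfun a \<in> c0"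
proof -
  have "bounded (range a)"
    using assms convergent_imp_bounded by (auto simp: convergent_def)
  then show *: "apply_bcontfun (Bcontfun a) = a"
    by (intro Bcontfun_inverse) (simp add: bcontfun_def)
  show "Bcontfun a \<in> c0"
    using assms by (simp add: c0_def *)
qed

lemma subspace_c0: "complex_vector.subspace c0"
proof (rule complex_vector.subspaceI)
  show "(0 :: nat \<Rightarrow>\<^sub>C complex) \<in> c0"
    by (simp add: c0_def zero_bcontfun.rep_eq)
  show "u + v \<in> c0" if "u \<in> c0" "v \<in> c0" for u v
    using that tendsto_add[of u 0 sequentially v 0] by (simp add: c0_def plus_bcontfun.rep_eq)
  show "a *\<^sub>C u \<in> c0" if "u \<in> c0" for a u
    using that tendsto_mult_right_zero[of u sequentially a]
    by (simp add: c0_def apply_bcontfun_scaleC scaleC_complex_def)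
qed

lemma closed_c0: "closed c0"
proof -
  have "l \<in> c0" if u: "\<And>n. u n \<in> c0" and lim: "u \<longlonglongrightarrow> l" for u :: "nat \<Rightarrow> nat \<Rightarrow>\<^sub>C complex" and l
  proof -
    have "apply_bcontfun l \<longlonglongrightarrow> 0"
    proof (rule swap_uniform_limit'[OF _ _ tendsto_bcontfun_uniform_limit[OF lim]])
      show "\<forall>\<^sub>F n in sequentially. (u n \<longlongrightarrow> 0) sequentially"
        using u by (simp add: c0_def)
    qed auto
    then show ?thesis
      by (simp add: c0_def)
  qed
  then show ?thesis
    by (auto simp: closed_sequential_limits)
qed

lemma complete_c0: "complete c0"
proof (rule completeI)
  fix u :: "nat \<Rightarrow> nat \<Rightarrow>\<^sub>C complex"
  assume u: "\<forall>n. u n \<in> c0" and "Cauchy u"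
  then have "uniformly_Cauchy_on UNIV (\<lambda>n. apply_bcontfun (u n))"
    unfolding Cauchy_def uniformly_Cauchy_on_def by (metis dist_fun_lt_imp_dist_val_lt)
  then have "uniformly_convergent_on UNIV (\<lambda>n. apply_bcontfun (u n))"
    by (rule Cauchy_uniformly_convergent)
  then obtain g where "uniform_limit UNIV u g sequentially"
    by (auto simp: uniformly_convergent_on_def)
  from uniform_limit_bcontfunE[OF this sequentially_bot]
  obtain l where l: "u \<longlonglongrightarrow> l"
    by metis
  then have "l \<in> c0"
    using closed_c0 u by (metis closed_sequential_limits)
  with l show "\<exists>l\<in>c0. u \<longlonglongrightarrow> l"
    by blast
qed

text \<open>
  An isomorphic embedding of \<^const>\<open>c0\<close> has a closed range because it reflects Cauchy sequences
  and \<^const>\<open>c0\<close> is complete. All conditions on \<open>J\<close> are confined to \<^const>\<open>c0\<close>, so that it may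
  be given by a series that diverges for other bounded sequences.
\<close>

lemma contains_copy_of_c0I:
  fixes J :: "(nat \<Rightarrow>\<^sub>C complex) \<Rightarrow> 'a::complex_normed_vector"
  assumes add: "\<And>u v. u \<in> c0 \<Longrightarrow> v \<in> c0 \<Longrightarrow> J (u + v) = J u + J v"
    and sc: "\<And>a u. u \<in> c0 \<Longrightarrow> J (a *\<^sub>C u) = a *\<^sub>C J u"
    and upper: "\<And>u. u \<in> c0 \<Longrightarrow> norm (J u) \<le> C * norm u"
    and lower: "\<And>u. u \<in> c0 \<Longrightarrow> c * norm u \<le> norm (J u)"
    and c: "c > 0"
  shows "contains_copy_of_c0 TYPE('a)"
proof -
  note c0 = complex_vector.subspace_add[OF subspace_c0] complex_vector.subspace_scale[OF subspace_c0]
    complex_vector.subspace_diff[OF subspace_c0] complex_vector.subspace_0[OF subspace_c0]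
    complex_vector.subspace_neg[OF subspace_c0]
  have diff: "J (u - v) = J u - J v" if "u \<in> c0" "v \<in> c0" for u v
    using add[of u "- v"] sc[of v "-1"] that c0
    by (simp add: scaleC_one)
  have upper': "dist (J u) (J v) \<le> C * dist u v" if "u \<in> c0" "v \<in> c0" for u v
    using upper[of "u - v"] diff that c0 by (simp add: dist_norm)
  have lower': "c * dist u v \<le> dist (J u) (J v)" if "u \<in> c0" "v \<in> c0" for u v
    using lower[of "u - v"] diff that c0 by (simp add: dist_norm)
  have inj: "inj_on J c0"
  proof (rule inj_onI)
    fix u v assume uv: "u \<in> c0" "v \<in> c0" "J u = J v"
    then have "c * dist u v \<le> 0"
      using lower'[of u v] by simp
    then show "u = v"
      using c by (simp add: mult_le_0_iff)
  qed
  have sub: "complex_vector.subspace (J ` c0)"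
  proof (rule complex_vector.subspaceI)
    show "0 \<in> J ` c0"
      using sc[of 0 0] c0(4) by (metis complex_vector.scale_zero_left image_eqI)
    show "x + y \<in> J ` c0" if "x \<in> J ` c0" "y \<in> J ` c0" for x y
      using that c0(1) by (metis (no_types, opaque_lifting) add image_iff)
    show "a *\<^sub>C x \<in> J ` c0" if "x \<in> J ` c0" for x a
      using that c0(2) by (metis (no_types, opaque_lifting) sc image_iff)
  qed
  have contJ: "continuous_on c0 J"
  proof (rule continuous_on_subset)
    have "C * dist u v \<le> \<bar>C\<bar> * dist u v" for u v :: "nat \<Rightarrow>\<^sub>C complex"
      by (intro mult_right_mono) auto
    then have "dist (J u) (J v) \<le> \<bar>C\<bar> * dist u v" if "u \<in> c0" "v \<in> c0" for u v
      using upper'[OF that] order_trans by blast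
    then have "\<bar>C\<bar>-lipschitz_on c0 J"
      by (rule lipschitz_onI) simp_all
    then show "continuous_on c0 J"
      by (rule lipschitz_on_continuous_on)
  qed simp
  have contI: "continuous_on (J ` c0) (inv_into c0 J)"
  proof -
    have "(1/c)-lipschitz_on (J ` c0) (inv_into c0 J)"
      using lower' c inj by (intro lipschitz_onI) (auto simp: field_simps)
    then show ?thesis
      by (rule lipschitz_on_continuous_on)
  qed
  have "closed (J ` c0)"
  proof -
    have "l \<in> J ` c0" if x: "\<And>n. x n \<in> J ` c0" and lim: "x \<longlonglongrightarrow> l" for x l
    proof -
      define u where "u n = inv_into c0 J (x n)" for n
      have u: "u n \<in> c0" "x n = J (u n)" for n
        using x[of n] by (simp_all add: u_def inv_into_into f_inv_into_f)
      have "Cauchy u"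
      proof (rule metric_CauchyI)
        fix e :: real assume "e > 0"
        then have "e * c > 0" using c by simp
        with LIMSEQ_imp_Cauchy[OF lim] obtain N where N: "\<And>m n. m \<ge> N \<Longrightarrow> n \<ge> N \<Longrightarrow> dist (x m) (x n) < e * c"
          unfolding Cauchy_def by blast
        have "dist (u m) (u n) < e" if "m \<ge> N" "n \<ge> N" for m n
        proof -
          have "c * dist (u m) (u n) < c * e"
            using lower'[OF u(1) u(1), of m n] N[OF that] by (simp add: u(2) mult.commute)
          then show ?thesis
            using c by simp
        qed
        then show "\<exists>N. \<forall>m\<ge>N. \<forall>n\<ge>N. dist (u m) (u n) < e"
          by blast
      qed
      then obtain v where v: "v \<in> c0" "u \<longlonglongrightarrow> v"
        using complete_c0 u(1) by (auto simp: complete_def)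
      have "(\<lambda>n. J (u n)) \<longlonglongrightarrow> J v"
        using contJ v u(1) by (simp add: continuous_on_sequentially comp_def)
      then have "l = J v"
        using lim u(2) by (metis LIMSEQ_unique ext)
      then show ?thesis
        using v by blast
    qed
    then show ?thesis
      by (auto simp: closed_sequential_limits)
  qed
  moreover have "linearly_homeomorphic (J ` c0) c0"
    unfolding linearly_homeomorphic_def
  proof (intro exI[of _ "inv_into c0 J"] exI[of _ J] conjI)
    show "homeomorphism (J ` c0) c0 (inv_into c0 J) J"
      using contJ contI inj by (auto simp: homeomorphism_def image_inv_into_cancel f_inv_into_f
        intro!: image_eqI[of _ _ "J _"])
    show "\<forall>x\<in>J ` c0. \<forall>y\<in>J ` c0. inv_into c0 J (x + y) = inv_into c0 J x + inv_into c0 J y"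
    proof safe
      fix u v assume "u \<in> c0" "v \<in> c0"
      then show "inv_into c0 J (J u + J v) = inv_into c0 J (J u) + inv_into c0 J (J v)"
        using inj c0(1)[of u v] inv_into_f_f[OF inj, of "u + v"] by (simp add: add)
    qed
    show "\<forall>a. \<forall>x\<in>J ` c0. inv_into c0 J (a *\<^sub>C x) = a *\<^sub>C inv_into c0 J x"
    proof safe
      fix a u assume "u \<in> c0"
      then show "inv_into c0 J (a *\<^sub>C J u) = a *\<^sub>C inv_into c0 J (J u)"
        using inj c0(2)[of u a] inv_into_f_f[OF inj, of "a *\<^sub>C u"] by (simp add: sc)
    qed
  qed
  ultimately show ?thesis
    using sub unfolding contains_copy_of_c0_def by blast
qed

lemma sum_abs_le_of_subset_sums:
  fixes r :: "'i \<Rightarrow> real"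
  assumes "finite A" and "\<And>B. B \<subseteq> A \<Longrightarrow> \<bar>sum r B\<bar> \<le> C"
  shows "(\<Sum>k\<in>A. \<bar>r k\<bar>) \<le> 2 * C"
proof -
  have "(\<Sum>k\<in>A. \<bar>r k\<bar>) = (\<Sum>k\<in>A. if r k \<ge> 0 then r k else - r k)"
    by (intro sum.cong) auto
  also have "\<dots> = sum r (A \<inter> {k. r k \<ge> 0}) - sum r (A \<inter> - {k. r k \<ge> 0})"
    using assms(1) by (simp add: sum.If_cases sum_negf)
  also have "\<dots> \<le> 2 * C"
    using assms(2)[of "A \<inter> {k. r k \<ge> 0}"] assms(2)[of "A \<inter> - {k. r k \<ge> 0}"] by auto
  finally show ?thesis .
qed

text \<open>
  Splitting the real and the imaginary parts according to sign turns the bound on subset sums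
  into absolute summability along every functional; the factor \<open>4\<close> counts the pieces.
\<close>

lemma functional_sum_le_of_subset_sums:
  fixes x :: "'i \<Rightarrow> 'a::complex_normed_vector"
  assumes \<phi>: "clinear_functional 1 \<phi>" and A: "finite A"
    and sums: "\<And>B. B \<subseteq> A \<Longrightarrow> norm (sum x B) \<le> C"
  shows "(\<Sum>k\<in>A. cmod (\<phi> (x k))) \<le> 4 * C"
proof -
  have cmod: "cmod (\<Sum>k\<in>B. \<phi> (x k)) \<le> C" if "B \<subseteq> A" for B
    using clinear_functionalD(3)[OF \<phi>, of "sum x B"] sums[OF that]
    by (simp add: clinear_functionalD(7)[OF \<phi>])
  have "(\<Sum>k\<in>A. \<bar>Re (\<phi> (x k))\<bar>) \<le> 2 * C"
    using A cmod abs_Re_le_cmod order_trans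
    by (intro sum_abs_le_of_subset_sums) (auto simp flip: Re_sum, blast+)
  moreover have "(\<Sum>k\<in>A. \<bar>Im (\<phi> (x k))\<bar>) \<le> 2 * C"
    using A cmod abs_Im_le_cmod order_trans
    by (intro sum_abs_le_of_subset_sums) (auto simp flip: Im_sum, blast+)
  moreover have "(\<Sum>k\<in>A. cmod (\<phi> (x k))) \<le> (\<Sum>k\<in>A. \<bar>Re (\<phi> (x k))\<bar> + \<bar>Im (\<phi> (x k))\<bar>)"
    by (intro sum_mono cmod_le)
  ultimately show ?thesis
    by (simp add: sum.distrib)
qed

lemma functional_combination_le:
  assumes \<phi>: "clinear_functional D \<phi>" and a: "\<And>k. k \<in> A \<Longrightarrow> cmod (a k) \<le> b"
  shows "cmod (\<phi> (\<Sum>k\<in>A. a k *\<^sub>C x k)) \<le> b * (\<Sum>k\<in>A. cmod (\<phi> (x k)))"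
proof -
  have "cmod (\<phi> (\<Sum>k\<in>A. a k *\<^sub>C x k)) \<le> (\<Sum>k\<in>A. cmod (a k * \<phi> (x k)))"
    unfolding clinear_functionalD(7)[OF \<phi>] clinear_functionalD(2)[OF \<phi>] by (rule norm_sum)
  also have "\<dots> \<le> (\<Sum>k\<in>A. b * cmod (\<phi> (x k)))"
    unfolding norm_mult by (intro sum_mono mult_right_mono a) auto
  finally show ?thesis
    by (simp add: sum_distrib_left)
qed

text \<open>
  The upper \<open>c\<^sub>0\<close>-estimate, seen by a functional norming the combination.
\<close>

lemma norm_combination_le_of_subset_sums:
  fixes x :: "'i \<Rightarrow> 'a::complex_normed_vector"
  assumes A: "finite A" and sums: "\<And>B. B \<subseteq> A \<Longrightarrow> norm (sum x B) \<le> C"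
    and a: "\<And>k. k \<in> A \<Longrightarrow> cmod (a k) \<le> b" and b: "b \<ge> 0"
  shows "norm (\<Sum>k\<in>A. a k *\<^sub>C x k) \<le> 4 * C * b"
proof -
  obtain \<phi> where \<phi>: "clinear_functional 1 \<phi>"
    and v: "\<phi> (\<Sum>k\<in>A. a k *\<^sub>C x k) = norm (\<Sum>k\<in>A. a k *\<^sub>C x k)"
    using norming_functional by blast
  have "norm (\<Sum>k\<in>A. a k *\<^sub>C x k) = cmod (\<phi> (\<Sum>k\<in>A. a k *\<^sub>C x k))"
    by (simp add: v)
  also have "\<dots> \<le> b * (\<Sum>k\<in>A. cmod (\<phi> (x k)))"
    using \<phi> a by (rule functional_combination_le)
  also have "\<dots> \<le> b * (4 * C)"
    using functional_sum_le_of_subset_sums[OF \<phi> A sums] b by (intro mult_left_mono)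
  finally show ?thesis
    by (simp add: mult_ac)
qed

text \<open>
  Rosenthal's disjointness lemma. Split the index set into infinitely many infinite blocks. If no
  block will do, each contains a row \<open>k\<close> with more than \<open>e\<close> of its sum inside its own block but off
  the diagonal. These rows, one per block, form an infinite index set avoiding all of that mass,
  so the row sums along it are smaller by at least \<open>e\<close>. The bound \<open>n * e\<close> on the row sums can
  drop only \<open>n\<close> times.
\<close>

lemma rosenthal_disjointness:
  fixes a :: "nat \<Rightarrow> nat \<Rightarrow> real"
  assumes M: "infinite M" and e: "e > 0"
    and row: "\<And>k F. k \<in> M \<Longrightarrow> finite F \<Longrightarrow> F \<subseteq> M \<Longrightarrow> (\<Sum>j\<in>F. a k j) \<le> real n * e"
  shows "\<exists>N\<subseteq>M. infinite N \<and> (\<forall>k\<in>N. \<forall>F\<subseteq>N - {k}. finite F \<longrightarrow> (\<Sum>j\<in>F. a k j) \<le> e)"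
  using M row
proof (induction n arbitrary: M)
  case 0
  then have "(\<Sum>j\<in>F. a k j) \<le> e" if "k \<in> M" "finite F" "F \<subseteq> M - {k}" for k F
  proof -
    have "F \<subseteq> M"
      using that by blast
    then show ?thesis
      using 0(2)[OF that(1,2)] e by simp
  qed
  then show ?case
    using 0 by blast
next
  case (Suc n)
  obtain r :: "nat \<Rightarrow> nat" where r: "strict_mono r" "\<And>i. r i \<in> M"
    using infinite_enumerate[OF Suc.prems(1)] by blast
  \<comment> \<open>The blocks are the images of the columns of a pairing of the natural numbers.\<close>
  define P where "P p = range (\<lambda>q. r (prod_encode (p, q)))" for p
  have inj: "inj (\<lambda>pq. r (prod_encode pq))"
    using inj_compose[OF strict_mono_imp_inj_on[OF r(1)] inj_prod_encode] by (simp add: comp_def)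
  have P: "P p \<subseteq> M" "infinite (P p)" for p
  proof -
    show "P p \<subseteq> M"
      using r(2) by (auto simp: P_def)
    have "inj (\<lambda>q. r (prod_encode (p, q)))"
      by (rule injI) (use injD[OF inj] in blast)
    then show "infinite (P p)"
      unfolding P_def by (rule range_inj_infinite)
  qed
  have disj: "p = p'" if "i \<in> P p" "i \<in> P p'" for i p p'
  proof -
    obtain q where q: "i = r (prod_encode (p, q))"
      using \<open>i \<in> P p\<close> unfolding P_def by blast
    obtain q' where q': "i = r (prod_encode (p', q'))"
      using \<open>i \<in> P p'\<close> unfolding P_def by blast
    show ?thesis
      using injD[OF inj, of "(p, q)" "(p', q')"] q q' by simp
  qed
  show ?case
  proof (cases "\<exists>p. \<forall>k\<in>P p. \<forall>F\<subseteq>P p - {k}. finite F \<longrightarrow> (\<Sum>j\<in>F. a k j) \<le> e")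
    case True
    then show ?thesis
      using P by blast
  next
    case False
    then have "\<forall>p. \<exists>k F. k \<in> P p \<and> F \<subseteq> P p - {k} \<and> finite F \<and> (\<Sum>j\<in>F. a k j) > e"
      by (meson not_le)
    then obtain k F where kF: "\<And>p. k p \<in> P p" "\<And>p. F p \<subseteq> P p - {k p}" "\<And>p. finite (F p)"
      "\<And>p. (\<Sum>j\<in>F p. a (k p) j) > e"
      by metis
    have "inj k"
      using kF(1) disj by (metis injI)
    then have inf: "infinite (range k)"
      by (rule range_inj_infinite)
    have "(\<Sum>j\<in>H. a i j) \<le> real n * e" if i: "i \<in> range k" and H: "finite H" "H \<subseteq> range k" for i H
    proof -
      obtain p where p: "i = k p" using i by blast
      have "H \<inter> F p = {}"
      proof (rule equals0I)
        fix j assume j: "j \<in> H \<inter> F p"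
        then obtain q where q: "j = k q"
          using H(2) by blast
        have "j \<in> P p" "j \<noteq> k p"
          using j kF(2)[of p] by auto
        moreover have "q = p"
          using disj[of j q p] kF(1)[of q] q \<open>j \<in> P p\<close> by simp
        ultimately show False
          using q by simp
      qed
      then have "(\<Sum>j\<in>H \<union> F p. a i j) = (\<Sum>j\<in>H. a i j) + (\<Sum>j\<in>F p. a i j)"
        using H kF(3) by (intro sum.union_disjoint) auto
      moreover have "(\<Sum>j\<in>H \<union> F p. a i j) \<le> real (Suc n) * e"
      proof (rule Suc.prems(2))
        show "i \<in> M"
          using subsetD[OF P(1) kF(1)] by (simp add: p)
        show "H \<union> F p \<subseteq> M"
          using H(2) subsetD[OF P(1) kF(1)] kF(2)[of p] P(1)[of p] by blast
      qed (use H kF(3) in simp)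
      ultimately show ?thesis
        using kF(4)[of p] by (simp add: p algebra_simps)
    qed
    with Suc.IH[OF inf] obtain N where
      "N \<subseteq> range k" "infinite N" "\<forall>k\<in>N. \<forall>F\<subseteq>N - {k}. finite F \<longrightarrow> (\<Sum>j\<in>F. a k j) \<le> e"
      by blast
    moreover have "range k \<subseteq> M"
      using subsetD[OF P(1) kF(1)] by blast
    ultimately show ?thesis
      by (intro exI[of _ N]) simp
  qed
qed

text \<open>
  With \<open>\<phi> k\<close> norming \<open>x k\<close>, Rosenthal's lemma provides a subsequence \<open>y\<close> on which \<open>\<phi> k\<close> maps
  the other terms to values of total modulus at most \<open>\<delta>/2\<close>. Applying \<open>\<phi> k\<close> to a combination
  bounds its norm below by \<open>\<delta>\<close> times the modulus of the coefficient of index \<open>k\<close>, minus \<open>\<delta>/2\<close>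
  times the supremum of all coefficients; choosing the best \<open>k\<close> leaves \<open>\<delta>/2\<close> times the supremum.
\<close>

lemma contains_copy_of_c0_of_bounded_sums:
  fixes x :: "nat \<Rightarrow> 'a::{complex_normed_vector, banach}"
  assumes sums: "\<And>F. finite F \<Longrightarrow> norm (sum x F) \<le> C"
    and low: "\<And>k. norm (x k) \<ge> \<delta>" and \<delta>: "\<delta> > 0"
  shows "contains_copy_of_c0 TYPE('a)"
proof -
  obtain \<phi> where \<phi>: "\<And>k. clinear_functional 1 (\<phi> k)" "\<And>k. \<phi> k (x k) = norm (x k)"
  proof -
    have "\<exists>\<psi>. clinear_functional 1 \<psi> \<and> \<psi> (x k) = norm (x k)" for k
      using norming_functional[of "x k"] by blast
    then show ?thesis
      using that by metis
  qed
  define a where "a k j = cmod (\<phi> k (x j))" for k j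
  obtain n :: nat where n: "4 * C / (\<delta>/2) \<le> real n"
    using real_arch_simple by blast
  have "(\<Sum>j\<in>F. a k j) \<le> real n * (\<delta>/2)" if "finite F" for k F
  proof -
    have "(\<Sum>j\<in>F. a k j) \<le> 4 * C"
      unfolding a_def
      by (rule functional_sum_le_of_subset_sums[OF \<phi>(1) that]) (rule sums, rule finite_subset[OF _ that])
    then show ?thesis
      using n \<delta> by (simp add: field_simps)
  qed
  then obtain N where N: "infinite N"
    "\<And>k F. k \<in> N \<Longrightarrow> F \<subseteq> N - {k} \<Longrightarrow> finite F \<Longrightarrow> (\<Sum>j\<in>F. a k j) \<le> \<delta>/2"
    using rosenthal_disjointness[of UNIV "\<delta>/2" a n] \<delta> by auto
  obtain r :: "nat \<Rightarrow> nat" where r: "strict_mono r" "\<And>i. r i \<in> N"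
    using infinite_enumerate[OF N(1)] by blast
  have inj: "inj_on r A" for A
    using r(1) by (simp add: strict_mono_imp_inj_on inj_on_subset)
  define y where "y k = x (r k)" for k
  have sums_y: "norm (sum y F) \<le> C" if "finite F" for F
    using sums[of "r ` F"] that by (simp add: y_def sum.reindex[OF inj] comp_def)
  have C: "C \<ge> 0"
    using sums[of "{}"] by simp
  have upper_fin: "norm (\<Sum>k\<in>F. u k *\<^sub>C y k) \<le> 4 * C * b"
    if "finite F" "\<And>k. k \<in> F \<Longrightarrow> cmod (u k) \<le> b" "b \<ge> 0" for F u b
    by (rule norm_combination_le_of_subset_sums[OF that(1) _ that(2,3)])
       (rule sums_y, rule finite_subset[OF _ that(1)])
  have lower_fin: "\<delta> * cmod (u k) - \<delta>/2 * norm u \<le> norm (\<Sum>j<m. u j *\<^sub>C y j)"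
    if "k < m" for u :: "nat \<Rightarrow>\<^sub>C complex" and k m
  proof -
    let ?f = "\<phi> (r k)" and ?A = "{..<m} - {k}"
    have "(\<Sum>j\<in>?A. cmod (?f (y j))) = (\<Sum>j\<in>r ` ?A. a (r k) j)"
      by (simp add: sum.reindex[OF inj] a_def y_def comp_def)
    also have "\<dots> \<le> \<delta>/2"
      using r strict_mono_eq[OF r(1)] by (intro N(2)) auto
    finally have off: "(\<Sum>j\<in>?A. cmod (?f (y j))) \<le> \<delta>/2" .
    have "cmod (?f (\<Sum>j\<in>?A. u j *\<^sub>C y j)) \<le> norm u * (\<Sum>j\<in>?A. cmod (?f (y j)))"
      using \<phi>(1) norm_bounded by (intro functional_combination_le)
    also have "\<dots> \<le> norm u * (\<delta>/2)"
      using off by (intro mult_left_mono) auto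
    finally have rest: "cmod (?f (\<Sum>j\<in>?A. u j *\<^sub>C y j)) \<le> \<delta>/2 * norm u"
      by (simp add: mult.commute)
    have "(\<Sum>j<m. u j *\<^sub>C y j) = u k *\<^sub>C y k + (\<Sum>j\<in>?A. u j *\<^sub>C y j)"
      using that by (intro sum.remove) auto
    then have split: "?f (\<Sum>j<m. u j *\<^sub>C y j) = u k * ?f (y k) + ?f (\<Sum>j\<in>?A. u j *\<^sub>C y j)"
      by (simp add: clinear_functionalD[OF \<phi>(1)])
    have "\<delta> * cmod (u k) \<le> cmod (u k * ?f (y k))"
      using low[of "r k"] by (simp add: norm_mult \<phi>(2) y_def mult.commute mult_right_mono)
    also have "\<dots> \<le> cmod (?f (\<Sum>j<m. u j *\<^sub>C y j)) + cmod (?f (\<Sum>j\<in>?A. u j *\<^sub>C y j))"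
      unfolding split
      using norm_triangle_ineq4[of "u k * ?f (y k) + ?f (\<Sum>j\<in>?A. u j *\<^sub>C y j)" "?f (\<Sum>j\<in>?A. u j *\<^sub>C y j)"]
      by simp
    also have "\<dots> \<le> norm (\<Sum>j<m. u j *\<^sub>C y j) + \<delta>/2 * norm u"
      using clinear_functionalD(3)[OF \<phi>(1), of "r k" "\<Sum>j<m. u j *\<^sub>C y j"] rest by simp
    finally show ?thesis
      by simp
  qed
  have summable: "summable (\<lambda>k. u k *\<^sub>C y k)" if u: "u \<in> c0" for u
    unfolding summable_Cauchy
  proof (intro allI impI)
    fix e :: real assume e: "e > 0"
    define b where "b = e / (4 * C + 1)"
    have b: "b > 0" "4 * C * b < e"
      using e C by (simp_all add: b_def field_simps)
    obtain M where M: "\<And>k. k \<ge> M \<Longrightarrow> cmod (u k) < b"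
      using u b(1) unfolding c0_def lim_sequentially dist_norm by auto
    have "norm (\<Sum>k\<in>{m..<n}. u k *\<^sub>C y k) < e" if "m \<ge> M" for m n
    proof -
      have "norm (\<Sum>k\<in>{m..<n}. u k *\<^sub>C y k) \<le> 4 * C * b"
        using M that b by (intro upper_fin) (auto intro!: less_imp_le)
      then show ?thesis
        using b by linarith
    qed
    then show "\<exists>M. \<forall>m\<ge>M. \<forall>n. norm (\<Sum>k\<in>{m..<n}. u k *\<^sub>C y k) < e"
      by blast
  qed
  define J where "J u = (\<Sum>k. u k *\<^sub>C y k)" for u :: "nat \<Rightarrow>\<^sub>C complex"
  have lim: "(\<lambda>m. norm (\<Sum>k<m. u k *\<^sub>C y k)) \<longlonglongrightarrow> norm (J u)" if "u \<in> c0" for u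
    unfolding J_def using summable_LIMSEQ[OF summable[OF that]] by (rule tendsto_norm)
  show ?thesis
  proof (rule contains_copy_of_c0I)
    show "J (u + v) = J u + J v" if "u \<in> c0" "v \<in> c0" for u v
      unfolding J_def using suminf_add[OF summable summable] that
      by (simp add: plus_bcontfun.rep_eq scaleC_add_left)
    show "J (c *\<^sub>C u) = c *\<^sub>C J u" if "u \<in> c0" for c u
      unfolding J_def using bounded_linear.suminf[OF bounded_linear_scaleC summable[OF that], of c]
      by (simp add: apply_bcontfun_scaleC scaleC_complex_def scaleC_scaleC)
    show "norm (J u) \<le> 4 * C * norm u" if "u \<in> c0" for u
      using norm_bounded[of u] by (intro LIMSEQ_le_const2[OF lim[OF that]] exI[of _ 0] allI impI upper_fin) auto
    show "\<delta>/2 * norm u \<le> norm (J u)" if "u \<in> c0" for u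
    proof -
      have "\<delta> * cmod (u k) - \<delta>/2 * norm u \<le> norm (J u)" for k
        by (intro LIMSEQ_le_const[OF lim[OF that]] exI[of _ "Suc k"] allI impI lower_fin) auto
      then have "norm u \<le> (norm (J u) + \<delta>/2 * norm u) / \<delta>"
        using \<delta> by (intro norm_bound) (simp add: field_simps)
      then show ?thesis
        using \<delta> by (simp add: field_simps)
    qed
    show "\<delta>/2 > 0"
      using \<delta> by simp
  qed
qed

section \<open>Relative compactness and power-bounded operators\<close>

text \<open>
  Total boundedness with the centres of the balls taken from the family itself. This form compares
  indices directly and so lets compactness be transferred between two families.
\<close>

lemma relatively_compact_range_iff:
  fixes x :: "'i \<Rightarrow> 'a::complete_space"
  shows "relatively_compact (range x) \<longleftrightarrow> (\<forall>e>0. \<exists>I. finite I \<and> (\<forall>n. \<exists>m\<in>I. dist (x m) (x n) < e))"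
    (is "?L \<longleftrightarrow> ?R")
proof
  assume L: ?L
  show ?R
  proof (intro allI impI)
    fix e :: real assume "e > 0"
    then have "e / 2 > 0" by simp
    with L obtain K where K: "finite K" "closure (range x) \<subseteq> (\<Union>c\<in>K. ball c (e/2))"
      unfolding relatively_compact_def compact_eq_totally_bounded by blast
    define i where "i c = (SOME m. x m \<in> ball c (e/2))" for c
    have "\<exists>m\<in>i ` K. dist (x m) (x n) < e" for n
    proof -
      have "x n \<in> closure (range x)"
        by (rule subsetD[OF closure_subset rangeI])
      then obtain c where c: "c \<in> K" "x n \<in> ball c (e/2)"
        using K(2) by blast
      have "x (i c) \<in> ball c (e/2)"
        unfolding i_def using c(2) by (rule someI[of "\<lambda>m. x m \<in> ball c (e/2)"])
      then have "dist (x (i c)) (x n) < e"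
        using c(2) dist_triangle_half_r[of c "x (i c)" e "x n"] by simp
      with c(1) show ?thesis by blast
    qed
    with K(1) show "\<exists>I. finite I \<and> (\<forall>n. \<exists>m\<in>I. dist (x m) (x n) < e)"
      by blast
  qed
next
  assume R: ?R
  have "\<exists>K. finite K \<and> closure (range x) \<subseteq> (\<Union>c\<in>K. ball c e)" if "e > 0" for e
  proof -
    have "e / 2 > 0" using that by simp
    with R obtain I where I: "finite I" "\<And>n. \<exists>m\<in>I. dist (x m) (x n) < e/2"
      by blast
    have "closure (range x) \<subseteq> (\<Union>c\<in>x ` I. cball c (e/2))"
    proof (rule closure_minimal)
      show "range x \<subseteq> (\<Union>c\<in>x ` I. cball c (e/2))"
        using I(2) by (force intro: less_imp_le)
      show "closed (\<Union>c\<in>x ` I. cball c (e/2))"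
        using I(1) by (intro closed_UN) auto
    qed
    also have "\<dots> \<subseteq> (\<Union>c\<in>x ` I. ball c e)"
      using that by auto
    finally show ?thesis
      using I(1) by blast
  qed
  then show ?L
    by (simp add: relatively_compact_def compact_eq_totally_bounded complete_eq_closed)
qed

lemma bounded_clinear_funpow:
  assumes "bounded_clinear (T :: 'a \<Rightarrow> 'a::complex_normed_vector)"
  shows "bounded_linear (T ^^ n)"
proof (induction n)
  case 0
  then show ?case
    using bounded_linear_ident by (simp add: id_def)
next
  case (Suc n)
  then show ?case
    using bounded_linear_compose[of T "T ^^ n"] assms by (simp add: bounded_clinear_def comp_def)
qed

lemma power_bounded_bound:
  fixes T :: "'a::complex_normed_vector \<Rightarrow> 'a"
  assumes "power_bounded T"
  obtains M where "M > 0" "\<And>n x. norm ((T ^^ n) x) \<le> M * norm x"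
proof -
  obtain B where B: "\<And>n. onorm (T ^^ n) \<le> B"
    using assms unfolding power_bounded_def bdd_above_def by auto
  have "norm ((T ^^ n) x) \<le> max 1 B * norm x" for n x
  proof -
    have "norm ((T ^^ n) x) \<le> onorm (T ^^ n) * norm x"
      using assms by (intro onorm bounded_clinear_funpow) (simp add: power_bounded_def)
    also have "\<dots> \<le> max 1 B * norm x"
      using B[of n] by (intro mult_right_mono) auto
    finally show ?thesis .
  qed
  then show ?thesis
    by (intro that[of "max 1 B"]) auto
qed

text \<open>
  Power-boundedness of the inverse says that the powers of \<open>T\<close> are uniformly bounded below.
\<close>

lemma doubly_power_bounded_bounds:
  fixes T :: "'a::complex_normed_vector \<Rightarrow> 'a"
  assumes "doubly_power_bounded T"
  obtains M where "M > 0" "\<And>n x. norm ((T ^^ n) x) \<le> M * norm x"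
    "\<And>n x. norm x \<le> M * norm ((T ^^ n) x)"
proof -
  obtain S where S: "power_bounded S" "S \<circ> T = id" and T: "power_bounded T"
    using assms by (auto simp: doubly_power_bounded_def)
  obtain M where M: "M > 0" "\<And>n x. norm ((T ^^ n) x) \<le> M * norm x"
    using power_bounded_bound[OF T] by blast
  obtain L where L: "L > 0" "\<And>n x. norm ((S ^^ n) x) \<le> L * norm x"
    using power_bounded_bound[OF S(1)] by blast
  have inv: "(S ^^ n) ((T ^^ n) x) = x" for n x
  proof (induction n arbitrary: x)
    case (Suc n)
    have "S (T y) = y" for y
      using fun_cong[OF S(2), of y] by simp
    then show ?case
      using Suc[of x] by (simp add: funpow_swap1[of S])
  qed simp
  show ?thesis
  proof (rule that[of "max M L"])
    show "max M L > 0" using M by simp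
    show "norm ((T ^^ n) x) \<le> max M L * norm x" for n x
      by (rule order_trans[OF M(2)]) (simp add: mult_right_mono)
    show "norm x \<le> max M L * norm ((T ^^ n) x)" for n x
    proof -
      have "norm x \<le> L * norm ((T ^^ n) x)"
        using L(2)[of n "(T ^^ n) x"] by (simp add: inv)
      also have "\<dots> \<le> max M L * norm ((T ^^ n) x)"
        by (simp add: mult_right_mono)
      finally show ?thesis .
    qed
  qed
qed

section \<open>Non-compact orbits produce series with bounded subset sums\<close>

lemma displacement_eq_sum:
  fixes T :: "'a::real_normed_vector \<Rightarrow> 'a"
  assumes "\<And>n. bounded_linear (T ^^ n)"
  shows "(T ^^ m) x - x = (\<Sum>i<m. (T ^^ i) (T x - x))"
proof (induction m)
  case (Suc m)
  interpret bounded_linear "T ^^ m" by (rule assms)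
  show ?case
    by (simp add: diff Suc[symmetric] funpow_swap1)
qed simp

text \<open>
  If all pairs of indices at which the orbit of \<open>d = T x - x\<close> nearly agrees had nearly equal
  \<open>T\<^sup>m x\<close> and \<open>T\<^sup>n x\<close>, finite nets would transfer from the orbit of \<open>d\<close> to that of \<open>x\<close>. So some
  such pair is separated in the orbit of \<open>x\<close>, and shifting back by the smaller index gives \<open>p\<close>.
\<close>

lemma return_times:
  fixes T :: "'a::{complex_normed_vector, banach} \<Rightarrow> 'a"
  assumes lin: "\<And>n. bounded_linear (T ^^ n)"
    and M: "M > 0" "\<And>n x. norm ((T ^^ n) x) \<le> M * norm x" "\<And>n x. norm x \<le> M * norm ((T ^^ n) x)"
    and rc: "relatively_compact (range (\<lambda>n. (T ^^ (n + 1)) x - (T ^^ n) x))"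
    and nrc: "\<not> relatively_compact (range (\<lambda>n. (T ^^ n) x))"
  obtains \<delta> where "\<delta> > 0"
    "\<And>\<eta>. \<eta> > 0 \<Longrightarrow> \<exists>p. norm ((T ^^ p) (T x - x) - (T x - x)) < \<eta> \<and> norm ((T ^^ p) x - x) \<ge> \<delta>"
proof -
  obtain e where e: "e > 0" "\<And>I. finite I \<Longrightarrow> \<exists>n. \<forall>m\<in>I. e \<le> dist ((T ^^ m) x) ((T ^^ n) x)"
    using nrc unfolding relatively_compact_range_iff by (auto simp: not_less)
  have step: "\<exists>p. norm ((T ^^ p) (T x - x) - (T x - x)) < \<eta> \<and> norm ((T ^^ p) x - x) \<ge> e / M"
    if \<eta>: "\<eta> > 0" for \<eta>
  proof -
    define d where "d n = (T ^^ n) (T x - x)" for n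
    have d: "d = (\<lambda>n. (T ^^ (n + 1)) x - (T ^^ n) x)"
      using bounded_linear.linear[OF lin] by (auto simp: d_def linear_diff funpow_swap1)
    have "\<eta> / M > 0"
      using \<eta> M by simp
    then obtain I where I: "finite I" "\<And>n. \<exists>m\<in>I. dist (d m) (d n) < \<eta> / M"
      using rc unfolding d[symmetric] relatively_compact_range_iff by blast
    obtain n where n: "\<And>m. m \<in> I \<Longrightarrow> e \<le> dist ((T ^^ m) x) ((T ^^ n) x)"
      using e(2)[OF I(1)] by blast
    obtain m where m: "m \<in> I" "dist (d m) (d n) < \<eta> / M"
      using I(2) by blast
    define l p where "l = min m n" and "p = max m n - min m n"
    have shift: "norm ((T ^^ l) ((T ^^ p) y - y)) = dist ((T ^^ m) y) ((T ^^ n) y)" for y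
    proof -
      have "max m n = l + p"
        by (simp add: l_def p_def)
      then have "(T ^^ l) ((T ^^ p) y - y) = (T ^^ max m n) y - (T ^^ min m n) y"
        using bounded_linear.linear[OF lin] by (simp add: l_def linear_diff funpow_add)
      then show ?thesis
        by (auto simp: dist_norm norm_minus_commute max_def min_def)
    qed
    have "norm ((T ^^ p) (T x - x) - (T x - x)) \<le> M * dist (d m) (d n)"
      using M(3)[of "(T ^^ p) (T x - x) - (T x - x)" l] shift[of "T x - x"] by (simp add: d_def)
    also have "\<dots> < \<eta>"
      using m(2) M(1) by (simp add: field_simps)
    finally have close: "norm ((T ^^ p) (T x - x) - (T x - x)) < \<eta>" .
    have "e \<le> M * norm ((T ^^ p) x - x)"
      using n[OF m(1)] M(2)[of l "(T ^^ p) x - x"] shift[of x] by simp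
    then have "norm ((T ^^ p) x - x) \<ge> e / M"
      using M(1) by (simp add: field_simps)
    with close show ?thesis
      by blast
  qed
  show ?thesis
    by (rule that[of "e / M"]) (use e(1) M(1) step in auto)
qed

text \<open>
  The return times are chosen so that \<open>T\<^bsup>p k\<^esup>\<close> moves every \<open>z m\<close> with \<open>m \<le> p 0 + ... + p (k-1)\<close> by
  at most \<open>1 / 2\<^sup>k\<close>. Then \<open>z\<close> of a sum of distinct \<open>p i\<close> differs from the sum of the \<open>z (p i)\<close> by
  at most \<open>2\<close>, while \<open>z\<close> itself is bounded.
\<close>

lemma contains_copy_of_c0_of_noncompact_orbit:
  fixes T :: "'a::{complex_normed_vector, banach} \<Rightarrow> 'a"
  assumes lin: "\<And>n. bounded_linear (T ^^ n)"
    and M: "M > 0" "\<And>n x. norm ((T ^^ n) x) \<le> M * norm x" "\<And>n x. norm x \<le> M * norm ((T ^^ n) x)"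
    and rc: "relatively_compact (range (\<lambda>n. (T ^^ (n + 1)) x - (T ^^ n) x))"
    and nrc: "\<not> relatively_compact (range (\<lambda>n. (T ^^ n) x))"
  shows "contains_copy_of_c0 TYPE('a)"
proof -
  define d where "d = T x - x"
  define z where "z m = (T ^^ m) x - x" for m
  obtain \<delta> q where \<delta>: "\<delta> > 0" and q: "\<And>\<eta>. \<eta> > 0 \<Longrightarrow> norm ((T ^^ q \<eta>) d - d) < \<eta>"
    "\<And>\<eta>. \<eta> > 0 \<Longrightarrow> norm (z (q \<eta>)) \<ge> \<delta>"
  proof -
    obtain \<delta> where \<delta>: "\<delta> > 0"
      "\<And>\<eta>. \<eta> > 0 \<Longrightarrow> \<exists>p. norm ((T ^^ p) d - d) < \<eta> \<and> norm (z p) \<ge> \<delta>"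
      using return_times[OF lin M rc nrc] unfolding d_def z_def by blast
    then obtain q where "\<forall>\<eta>. \<eta> > 0 \<longrightarrow> norm ((T ^^ q \<eta>) d - d) < \<eta> \<and> norm (z (q \<eta>)) \<ge> \<delta>"
      by metis
    with \<delta>(1) show ?thesis
      using that by blast
  qed
  \<comment> \<open>As \<open>z m\<close> is a sum of \<open>m\<close> translates of \<open>d\<close>, the accuracy in step \<open>k\<close> depends on the sum \<open>t\<close>
    of the earlier return times.\<close>
  define \<eta> where "\<eta> k t = (1/2) ^ k / (M * (1 + real t))" for k t :: nat
  define s where "s = rec_nat 0 (\<lambda>k t. t + q (\<eta> k t))"
  define p where "p k = q (\<eta> k (s k))" for k
  have s: "s k = (\<Sum>i<k. p i)" for k
    by (induction k) (simp_all add: s_def p_def)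
  have \<eta>: "\<eta> k t > 0" for k t
    using M(1) by (simp add: \<eta>_def)
  have perturb: "norm ((T ^^ p k) (z m) - z m) \<le> (1/2) ^ k" if "m \<le> s k" for k m
  proof -
    have "(T ^^ p k) (z m) - z m = (\<Sum>i<m. (T ^^ i) ((T ^^ p k) d - d))"
    proof -
      have "(T ^^ p k) ((T ^^ i) d) = (T ^^ i) ((T ^^ p k) d)" for i
        by (metis add.commute comp_apply funpow_add)
      then show ?thesis
        unfolding z_def displacement_eq_sum[OF lin, of m x] d_def[symmetric]
        using bounded_linear.linear[OF lin] by (simp add: linear_sum linear_diff sum_subtractf)
    qed
    also have "norm \<dots> \<le> (\<Sum>i<m. M * \<eta> k (s k))"
    proof (rule sum_norm_le)
      fix i
      have "norm ((T ^^ i) ((T ^^ p k) d - d)) \<le> M * norm ((T ^^ p k) d - d)"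
        by (rule M(2))
      also have "\<dots> \<le> M * \<eta> k (s k)"
        using q(1)[OF \<eta>] M(1) by (intro mult_left_mono) (auto simp: p_def intro: less_imp_le)
      finally show "norm ((T ^^ i) ((T ^^ p k) d - d)) \<le> M * \<eta> k (s k)" .
    qed
    also have "\<dots> = (real m / (1 + real (s k))) * (1/2) ^ k"
      using M(1) by (simp add: \<eta>_def)
    also have "\<dots> \<le> 1 * (1/2) ^ k"
      using that by (intro mult_right_mono) (auto simp: field_simps)
    finally show ?thesis
      by simp
  qed
  have approx: "norm (z (sum p F) - (\<Sum>i\<in>F. z (p i))) \<le> (\<Sum>i<k. (1/2) ^ i)" if "F \<subseteq> {..<k}" for F k
    using that
  proof (induction k arbitrary: F)
    case 0
    then show ?case
      by (simp add: z_def)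
  next
    case (Suc k)
    define H where "H = F - {k}"
    have H: "H \<subseteq> {..<k}" "k \<notin> H"
      using Suc.prems by (auto simp: H_def)
    have "finite H"
      using H(1) finite_subset by blast
    note IH = Suc.IH[OF H(1)]
    show ?case
    proof (cases "k \<in> F")
      case False
      then have "F = H"
        by (simp add: H_def)
      with IH show ?thesis
        by (simp add: add_increasing2)
    next
      case True
      then have F: "F = insert k H"
        by (auto simp: H_def)
      let ?N = "sum p H"
      have "?N \<le> s k"
        unfolding s using H(1) by (intro sum_mono2) auto
      note pert = perturb[OF this]
      have "z (p k + ?N) = (T ^^ p k) (z ?N) + z (p k)"
        using bounded_linear.linear[OF lin] by (simp add: z_def funpow_add linear_diff)
      then have "z (sum p F) - (\<Sum>i\<in>F. z (p i)) =
          ((T ^^ p k) (z ?N) - z ?N) + (z ?N - (\<Sum>i\<in>H. z (p i)))"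
        using H \<open>finite H\<close> by (simp add: F)
      also have "norm \<dots> \<le> (1/2) ^ k + (\<Sum>i<k. (1/2) ^ i)"
        using pert IH by (rule norm_triangle_mono)
      finally show ?thesis
        by simp
    qed
  qed
  have "norm (\<Sum>i\<in>F. z (p i)) \<le> M * norm x + norm x + 2" if "finite F" for F
  proof -
    obtain k where "F \<subseteq> {..<k}"
      using finite_nat_bounded[OF \<open>finite F\<close>] by blast
    from approx[OF this] have "norm (z (sum p F) - (\<Sum>i\<in>F. z (p i))) \<le> (\<Sum>i<k. (1/2) ^ i)" .
    also have "\<dots> \<le> 2"
      by (simp add: sum_gp_strict)
    finally have "norm (z (sum p F) - (\<Sum>i\<in>F. z (p i))) \<le> 2" .
    moreover have "norm (z (sum p F)) \<le> M * norm x + norm x"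
      unfolding z_def by (rule order_trans[OF norm_triangle_ineq4 add_right_mono[OF M(2)]])
    ultimately show ?thesis
      using norm_triangle_sub[of "\<Sum>i\<in>F. z (p i)" "z (sum p F)"] by (simp add: norm_minus_commute)
  qed
  then show ?thesis
    using q(2)[OF \<eta>] \<delta> by (intro contains_copy_of_c0_of_bounded_sums[of "\<lambda>i. z (p i)" _ \<delta>]) (auto simp: p_def)
qed

section \<open>Multiplier operators along a copy of the null sequences\<close>

lemma bounded_of_continuous_on_subspace:
  fixes h :: "'a::complex_normed_vector \<Rightarrow> 'b::complex_normed_vector"
  assumes S: "complex_vector.subspace S" and cont: "continuous_on S h"
    and sc: "\<And>a x. x \<in> S \<Longrightarrow> h (a *\<^sub>C x) = a *\<^sub>C h x"
  obtains K where "K > 0" "\<And>x. x \<in> S \<Longrightarrow> norm (h x) \<le> K * norm x"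
proof -
  have 0: "0 \<in> S" "h 0 = 0"
    using complex_vector.subspace_0[OF S] sc[of 0 0] by simp_all
  then obtain d where d: "d > 0" "\<And>x. x \<in> S \<Longrightarrow> norm x < d \<Longrightarrow> norm (h x) < 1"
    using cont[unfolded continuous_on_iff, rule_format, of 0 1] by (auto simp: dist_norm)
  have "norm (h x) \<le> 2 / d * norm x" if x: "x \<in> S" for x
  proof (cases "x = 0")
    case False
    define r where "r = d / (2 * norm x)"
    have r: "r > 0" "r * norm x = d / 2"
      using False d(1) by (simp_all add: r_def)
    have "norm (complex_of_real r *\<^sub>C x) < d"
      using r d(1) by (simp add: norm_scaleC)
    then have "norm (h (complex_of_real r *\<^sub>C x)) < 1"
      using complex_vector.subspace_scale[OF S x] by (rule d(2)[rotated])
    then have "r * norm (h x) < 1"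
      using r(1) by (simp add: sc[OF x] norm_scaleC)
    then show ?thesis
      using False d(1) by (simp add: r_def field_simps)
  qed (simp add: 0)
  then show ?thesis
    using d(1) by (intro that[of "2 / d"]) auto
qed

text \<open>
  An embedding \<open>g\<close> of \<^const>\<open>c0\<close> together with a bounded family of functionals on the ambient space
  that recover the coordinates.
\<close>

locale biorthogonal_c0 =
  fixes \<phi> :: "nat \<Rightarrow> 'a::{complex_normed_vector, banach} \<Rightarrow> complex"
    and g :: "(nat \<Rightarrow>\<^sub>C complex) \<Rightarrow> 'a"
    and K C :: real
  assumes \<phi>: "\<And>k. clinear_functional K (\<phi> k)" and K: "K > 0"
    and g_add: "\<And>u v. u \<in> c0 \<Longrightarrow> v \<in> c0 \<Longrightarrow> g (u + v) = g u + g v"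
    and g_scaleC: "\<And>a u. u \<in> c0 \<Longrightarrow> g (a *\<^sub>C u) = a *\<^sub>C g u"
    and g_bound: "\<And>u. u \<in> c0 \<Longrightarrow> norm (g u) \<le> C * norm u" and C: "C > 0"
    and biorthogonal: "\<And>u k. u \<in> c0 \<Longrightarrow> \<phi> k (g u) = u k"
begin

text \<open>
  The summand \<open>\<phi> 0\<close> makes \<open>\<psi> k x\<close> fail to tend to \<open>0\<close> at \<open>x = e\<^sub>0\<close>, the image of the sequence
  \<open>(1, 0, 0, ...)\<close>, and this failure is the source of the non-compact orbit. On the span of the
  other basis vectors, \<open>\<psi> k\<close> agrees with \<open>\<phi> k\<close>.
\<close>

definition \<psi> :: "nat \<Rightarrow> 'a \<Rightarrow> complex"
  where "\<psi> k x = \<phi> k x + \<phi> 0 x"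

definition embed :: "(nat \<Rightarrow> complex) \<Rightarrow> 'a"
  where "embed s = g (Bcontfun s)"

text \<open>
  Convergence to \<open>1\<close> makes the coordinates \<open>(a k - 1) * \<psi> k x\<close> a null sequence; the condition
  \<open>a 0 = 1\<close> keeps the perturbation in the part of the copy where \<open>\<psi> k\<close> and \<open>\<phi> k\<close> agree.
\<close>

definition multiplier :: "(nat \<Rightarrow> complex) \<Rightarrow> bool"
  where "multiplier a \<longleftrightarrow> a 0 = 1 \<and> a \<longlonglongrightarrow> 1 \<and> (\<forall>k. cmod (a k) \<le> 1)"

definition mult_op :: "(nat \<Rightarrow> complex) \<Rightarrow> 'a \<Rightarrow> 'a"
  where "mult_op a x = x + embed (\<lambda>k. (a k - 1) * \<psi> k x)"

lemma \<psi>: "clinear_functional (2 * K) (\<psi> k)"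
proof -
  have "cmod (\<psi> k x) \<le> 2 * K * norm x" for x
    using norm_triangle_ineq[of "\<phi> k x" "\<phi> 0 x"] clinear_functionalD(3)[OF \<phi>, of k x]
      clinear_functionalD(3)[OF \<phi>, of 0 x] by (simp add: \<psi>_def)
  then show ?thesis
    by (simp add: clinear_functional_def \<psi>_def clinear_functionalD[OF \<phi>] distrib_left)
qed

lemma embed_add:
  assumes "s \<longlonglongrightarrow> 0" "t \<longlonglongrightarrow> 0"
  shows "embed (\<lambda>k. s k + t k) = embed s + embed t"
proof -
  have "(\<lambda>k. s k + t k) \<longlonglongrightarrow> 0"
    using tendsto_add[OF assms] by simp
  then have "Bcontfun (\<lambda>k. s k + t k) = Bcontfun s + Bcontfun t"
    using assms by (intro bcontfun_eqI) (simp add: apply_Bcontfun_null plus_bcontfun.rep_eq)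
  then show ?thesis
    using assms by (simp add: embed_def g_add Bcontfun_null_in_c0)
qed

lemma embed_mult:
  assumes "s \<longlonglongrightarrow> 0"
  shows "embed (\<lambda>k. c * s k) = c *\<^sub>C embed s"
proof -
  have "(\<lambda>k. c * s k) \<longlonglongrightarrow> 0"
    using assms by (rule tendsto_mult_right_zero)
  then have "Bcontfun (\<lambda>k. c * s k) = c *\<^sub>C Bcontfun s"
    using assms
    by (intro bcontfun_eqI) (simp add: apply_Bcontfun_null apply_bcontfun_scaleC scaleC_complex_def)
  then show ?thesis
    using assms by (simp add: embed_def g_scaleC Bcontfun_null_in_c0)
qed

lemma embed_diff:
  assumes "s \<longlonglongrightarrow> 0" "t \<longlonglongrightarrow> 0"
  shows "embed (\<lambda>k. s k - t k) = embed s - embed t"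
  using embed_add[OF assms(1) tendsto_mult_right_zero[OF assms(2), of "-1"]] embed_mult[OF assms(2), of "-1"]
  by (simp add: scaleC_one)

lemma norm_embed:
  assumes "s \<longlonglongrightarrow> 0" "\<And>k. cmod (s k) \<le> b"
  shows "norm (embed s) \<le> C * b"
proof -
  have "norm (Bcontfun s) \<le> b"
    using assms by (intro norm_bound) (simp add: apply_Bcontfun_null)
  then have "C * norm (Bcontfun s) \<le> C * b"
    using C by simp
  with g_bound[OF Bcontfun_null_in_c0[OF assms(1)]] show ?thesis
    by (simp add: embed_def)
qed

lemma null_mult_\<psi>:
  assumes "s \<longlonglongrightarrow> 0"
  shows "(\<lambda>k. s k * \<psi> k x) \<longlonglongrightarrow> 0"
proof (rule Lim_null_comparison)
  show "\<forall>\<^sub>F k in sequentially. norm (s k * \<psi> k x) \<le> cmod (s k) * (2 * K * norm x)"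
    using clinear_functionalD(3)[OF \<psi>] by (simp add: norm_mult mult_left_mono)
  show "(\<lambda>k. cmod (s k) * (2 * K * norm x)) \<longlonglongrightarrow> 0"
    using assms by (intro tendsto_mult_left_zero tendsto_norm_zero)
qed

lemma multiplier_null:
  assumes "multiplier a"
  shows "(\<lambda>k. (a k - 1) * \<psi> k x) \<longlonglongrightarrow> 0"
proof (rule null_mult_\<psi>)
  show "(\<lambda>k. a k - 1) \<longlonglongrightarrow> 0"
    using assms LIM_zero by (auto simp: multiplier_def)
qed

lemma \<phi>_embed: "s \<longlonglongrightarrow> 0 \<Longrightarrow> \<phi> k (embed s) = s k"
  by (simp add: embed_def biorthogonal Bcontfun_null_in_c0 apply_Bcontfun_null)

text \<open>
  The functionals \<open>\<psi> k\<close> are eigenvectors of the adjoint of \<open>mult_op a\<close>, with eigenvalues \<open>a k\<close>. This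
  is what makes \<open>mult_op\<close> multiplicative in the sequence \<open>a\<close>.
\<close>

lemma \<psi>_mult_op:
  assumes "multiplier a"
  shows "\<psi> k (mult_op a x) = a k * \<psi> k x"
proof -
  have "\<psi> k (mult_op a x) = \<psi> k x + ((a k - 1) * \<psi> k x + (a 0 - 1) * \<psi> 0 x)"
    by (simp only: mult_op_def clinear_functionalD(1)[OF \<psi>] \<psi>_def[of k "embed _"]
        \<phi>_embed[OF multiplier_null[OF assms]])
  then show ?thesis
    using assms by (simp add: multiplier_def algebra_simps)
qed

lemma multiplier_mult: "multiplier a \<Longrightarrow> multiplier b \<Longrightarrow> multiplier (\<lambda>k. a k * b k)"
  using tendsto_mult[of a 1 sequentially b 1]
  by (auto simp: multiplier_def norm_mult intro!: mult_le_one)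

lemma multiplier_power: "multiplier a \<Longrightarrow> multiplier (\<lambda>k. a k ^ n)"
  using tendsto_power[of a 1 sequentially n]
  by (auto simp: multiplier_def norm_power power_le_one)

lemma mult_op_mult:
  assumes "multiplier a" "multiplier b"
  shows "mult_op a (mult_op b x) = mult_op (\<lambda>k. a k * b k) x"
proof -
  have "(\<lambda>k. (a k - 1) * (b k * \<psi> k x)) \<longlonglongrightarrow> 0"
    using multiplier_null[OF assms(1), of "mult_op b x"] by (simp add: \<psi>_mult_op[OF assms(2)])
  from embed_add[OF multiplier_null[OF assms(2), of x] this] show ?thesis
    by (simp add: mult_op_def[of a "mult_op b x"] \<psi>_mult_op[OF assms(2)]) (simp add: mult_op_def algebra_simps)
qed

lemma mult_op_one: "mult_op (\<lambda>k. 1) x = x"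
  using norm_embed[of "\<lambda>k. 0" 0] by (simp add: mult_op_def)

lemma funpow_mult_op:
  assumes "multiplier a"
  shows "(mult_op a ^^ n) x = mult_op (\<lambda>k. a k ^ n) x"
proof (induction n)
  case (Suc n)
  then show ?case
    using mult_op_mult[OF assms multiplier_power[OF assms, of n]] by simp
qed (simp add: mult_op_one)

lemma mult_op_diff:
  assumes "multiplier a" "multiplier b"
  shows "mult_op a x - mult_op b x = embed (\<lambda>k. (a k - b k) * \<psi> k x)"
  using embed_diff[OF multiplier_null[OF assms(1), of x] multiplier_null[OF assms(2), of x]]
  by (simp add: mult_op_def algebra_simps)

lemma mult_op_add:
  assumes "multiplier a"
  shows "mult_op a (x + y) = mult_op a x + mult_op a y"
  using embed_add[OF multiplier_null[OF assms, of x] multiplier_null[OF assms, of y]]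
  by (simp add: mult_op_def clinear_functionalD[OF \<psi>] algebra_simps)

lemma mult_op_scaleC:
  assumes "multiplier a"
  shows "mult_op a (c *\<^sub>C x) = c *\<^sub>C mult_op a x"
  using embed_mult[OF multiplier_null[OF assms, of x], of c]
  by (simp add: mult_op_def clinear_functionalD[OF \<psi>] scaleC_add_right mult.left_commute)

lemma norm_mult_op:
  assumes "multiplier a"
  shows "norm (mult_op a x) \<le> (1 + C * (2 * (2 * K))) * norm x"
proof -
  have "cmod ((a k - 1) * \<psi> k x) \<le> 2 * (2 * K * norm x)" for k
    unfolding norm_mult
  proof (rule mult_mono)
    show "cmod (a k - 1) \<le> 2"
      using norm_triangle_ineq4[of "a k" 1] assms by (simp add: multiplier_def) (smt (verit))
  qed (use clinear_functionalD(3)[OF \<psi>] in auto)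
  from norm_embed[OF multiplier_null[OF assms] this] show ?thesis
    using norm_triangle_ineq[of x "embed (\<lambda>k. (a k - 1) * \<psi> k x)"]
    by (simp add: mult_op_def algebra_simps)
qed

lemma bounded_clinear_mult_op:
  assumes "multiplier a"
  shows "bounded_clinear (mult_op a)"
  unfolding bounded_clinear_def
proof
  show "bounded_linear (mult_op a)"
    using norm_mult_op[OF assms]
    by (intro bounded_linear_intro[of _ "1 + C * (2 * (2 * K))"])
       (simp_all add: mult_op_add[OF assms] mult_op_scaleC[OF assms] scaleR_scaleC mult.commute)
  show "Vector_Spaces.linear (*\<^sub>C) (*\<^sub>C) (mult_op a)"
    by unfold_locales (simp_all add: mult_op_add[OF assms] mult_op_scaleC[OF assms])
qed

lemma power_bounded_mult_op:
  assumes "multiplier a"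
  shows "power_bounded (mult_op a)"
proof -
  have "onorm (mult_op a ^^ n) \<le> 1 + C * (2 * (2 * K))" for n
    using norm_mult_op[OF multiplier_power[OF assms]] K C
    by (intro onorm_bound) (simp_all add: funpow_mult_op[OF assms])
  then show ?thesis
    using bounded_clinear_mult_op[OF assms] by (auto simp: power_bounded_def bdd_above_def)
qed

lemma doubly_power_bounded_mult_op:
  assumes "multiplier a" and unimodular: "\<And>k. cmod (a k) = 1"
  shows "doubly_power_bounded (mult_op a)"
proof -
  define b where "b k = cnj (a k)" for k
  have ab: "a k * b k = 1" for k
    using complex_norm_square[of "a k"] unimodular by (simp add: b_def)
  have b: "multiplier b"
    using assms tendsto_cnj[of a 1 sequentially] by (simp add: multiplier_def b_def[abs_def])
  have "mult_op b \<circ> mult_op a = id" "mult_op a \<circ> mult_op b = id"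
    using mult_op_mult[OF assms(1) b] mult_op_mult[OF b assms(1)] ab by (simp_all add: fun_eq_iff mult.commute mult_op_one)
  then show ?thesis
    using power_bounded_mult_op[OF assms(1)] power_bounded_mult_op[OF b] unfolding doubly_power_bounded_def by blast
qed

text \<open>
  A root of unity of order \<open>2\<^sup>k\<close>. In any finite number of coordinates the powers of this sequence
  are periodic, which yields finite nets, while the values \<open>-1\<close> at half a period keep the powers
  \<open>\<mu>\<^bsup>2^j\<^esup>\<close> uniformly apart.
\<close>

definition \<mu> :: "nat \<Rightarrow> complex"
  where "\<mu> k = cis (2 * pi / 2 ^ k)"

lemma cmod_\<mu> [simp]: "cmod (\<mu> k) = 1"
  by (simp add: \<mu>_def)

lemma multiplier_\<mu>: "multiplier \<mu>"
proof -
  have "(\<lambda>k. 2 * pi * (1/2) ^ k) \<longlonglongrightarrow> 2 * pi * 0"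
    by (intro tendsto_intros LIMSEQ_power_zero) simp
  then have "(\<lambda>k. 2 * pi / 2 ^ k) \<longlonglongrightarrow> 0"
    by (simp add: power_divide)
  then have "(\<lambda>k. cis (2 * pi / 2 ^ k)) \<longlonglongrightarrow> cis 0"
    by (rule tendsto_cis)
  then show ?thesis
    by (simp add: multiplier_def \<mu>_def[abs_def])
qed

lemma \<mu>_period: "\<mu> k ^ (2 ^ k) = 1"
proof -
  have "\<mu> k ^ (2 ^ k) = cis (2 * pi)"
    by (simp add: \<mu>_def Complex.DeMoivre)
  then show ?thesis
    by simp
qed

lemma \<mu>_half_period: "\<mu> (Suc k) ^ (2 ^ k) = -1"
proof -
  have "\<mu> (Suc k) ^ (2 ^ k) = cis pi"
    by (simp add: \<mu>_def Complex.DeMoivre)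
  then show ?thesis
    by simp
qed

lemma \<mu>_power_mod:
  assumes "k \<le> L"
  shows "\<mu> k ^ (n mod 2 ^ L) = \<mu> k ^ n"
proof -
  have "\<mu> k ^ (2 ^ L) = 1"
    using \<mu>_period[of k] assms by (metis le_add_diff_inverse power_add power_mult power_one)
  then have "\<mu> k ^ n = \<mu> k ^ (n mod 2 ^ L) * (\<mu> k ^ (2 ^ L)) ^ (n div 2 ^ L)"
    by (metis div_mult_mod_eq mult.commute power_add power_mult)
  then show ?thesis
    using \<open>\<mu> k ^ (2 ^ L) = 1\<close> by simp
qed

text \<open>
  The coordinates beyond some \<open>L\<close> are uniformly small because of the factor \<open>\<mu> k - 1\<close>, and the ones up
  to \<open>L\<close> depend only on \<open>n\<close> modulo \<open>2\<^sup>L\<close>. So the differences with \<open>n < 2\<^sup>L\<close> form a finite net.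
\<close>

lemma relatively_compact_differences:
  "relatively_compact (range (\<lambda>n. (mult_op \<mu> ^^ (n + 1)) x - (mult_op \<mu> ^^ n) x))"
  unfolding relatively_compact_range_iff
proof (intro allI impI)
  fix e :: real assume e: "e > 0"
  define D where "D n = (mult_op \<mu> ^^ (n + 1)) x - (mult_op \<mu> ^^ n) x" for n
  define b where "b = e / (2 * C)"
  have b: "b > 0" "C * b < e"
    using e C by (simp_all add: b_def)
  have pow: "multiplier (\<lambda>k. \<mu> k ^ n)" for n
    by (rule multiplier_power[OF multiplier_\<mu>])
  have D: "D n = embed (\<lambda>k. (\<mu> k ^ (n + 1) - \<mu> k ^ n) * \<psi> k x)" for n
    unfolding D_def funpow_mult_op[OF multiplier_\<mu>] by (rule mult_op_diff[OF pow pow])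
  have null: "(\<lambda>k. (\<mu> k ^ (n + 1) - \<mu> k ^ n) * \<psi> k x) \<longlonglongrightarrow> 0" for n
  proof (rule null_mult_\<psi>)
    show "(\<lambda>k. \<mu> k ^ (n + 1) - \<mu> k ^ n) \<longlonglongrightarrow> 0"
      using tendsto_diff[of "\<lambda>k. \<mu> k ^ (n + 1)" 1 sequentially "\<lambda>k. \<mu> k ^ n" 1] pow[of "n + 1"] pow[of n]
      by (simp add: multiplier_def)
  qed
  have "b / 2 > 0"
    using b by simp
  with multiplier_null[OF multiplier_\<mu>, of x] obtain L where
    L: "\<And>k. k \<ge> L \<Longrightarrow> cmod ((\<mu> k - 1) * \<psi> k x) < b / 2"
    unfolding lim_sequentially dist_norm by (metis diff_zero)
  have "dist (D (n mod 2 ^ L)) (D n) < e" for n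
  proof -
    let ?m = "n mod 2 ^ L"
    have "cmod ((\<mu> k ^ (?m + 1) - \<mu> k ^ ?m) * \<psi> k x - (\<mu> k ^ (n + 1) - \<mu> k ^ n) * \<psi> k x) \<le> b" for k
    proof (cases "k \<le> L")
      case True
      then show ?thesis
        using \<mu>_power_mod[OF True, of n] b(1) by simp
    next
      case False
      have "(\<mu> k ^ (?m + 1) - \<mu> k ^ ?m) * \<psi> k x - (\<mu> k ^ (n + 1) - \<mu> k ^ n) * \<psi> k x
          = (\<mu> k ^ ?m - \<mu> k ^ n) * ((\<mu> k - 1) * \<psi> k x)"
        by (simp add: algebra_simps)
      moreover have "cmod (\<mu> k ^ ?m - \<mu> k ^ n) \<le> 2"
        using norm_triangle_ineq4[of "\<mu> k ^ ?m" "\<mu> k ^ n"] by (simp add: norm_power)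
      moreover have "cmod ((\<mu> k - 1) * \<psi> k x) \<le> b / 2"
        using L[of k] False by simp
      ultimately show ?thesis
        using mult_mono[of "cmod (\<mu> k ^ ?m - \<mu> k ^ n)" 2 "cmod ((\<mu> k - 1) * \<psi> k x)" "b / 2"]
        by (simp add: norm_mult)
    qed
    then have "norm (D ?m - D n) \<le> C * b"
      using tendsto_diff[OF null[of ?m] null[of n]]
      unfolding D embed_diff[OF null[of ?m] null[of n], symmetric]
      by (intro norm_embed) auto
    then show ?thesis
      using b(2) by (simp add: dist_norm)
  qed
  then have "\<exists>m\<in>{..<2 ^ L}. dist (D m) (D n) < e" for n
    by (intro bexI[of _ "n mod 2 ^ L"]) auto
  then show "\<exists>I. finite I \<and> (\<forall>n. \<exists>m\<in>I. dist (D m) (D n) < e)"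
    by (intro exI[of _ "{..<2 ^ L}"]) simp
qed

text \<open>
  At \<open>x = e\<^sub>0\<close>, the points of the orbit with times \<open>2\<^sup>i\<close> and \<open>2\<^sup>j\<close>, where \<open>i < j\<close>, are told apart by
  \<open>\<psi> (i + 1)\<close>, which takes the values \<open>-1\<close> and \<open>1\<close> there.
\<close>

lemma not_relatively_compact_orbit:
  "\<exists>x. \<not> relatively_compact (range (\<lambda>n. (mult_op \<mu> ^^ n) x))"
proof -
  define \<delta> where "\<delta> k = (if k = 0 then 1 else 0 :: complex)" for k :: nat
  define x where "x = embed \<delta>"
  have "\<delta> \<longlonglongrightarrow> 0"
    by (rule tendsto_eventually) (auto simp: \<delta>_def eventually_sequentially intro!: exI[of _ 1])
  then have \<psi>x: "\<psi> (Suc k) x = 1" for k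
    by (simp add: \<psi>_def x_def \<phi>_embed \<delta>_def)
  define y where "y j = (mult_op \<mu> ^^ (2 ^ j)) x" for j
  have \<psi>y: "\<psi> (Suc k) (y j) = \<mu> (Suc k) ^ (2 ^ j)" for j k
    by (simp add: y_def funpow_mult_op[OF multiplier_\<mu>] \<psi>_mult_op[OF multiplier_power[OF multiplier_\<mu>]] \<psi>x)
  have sep: "1 / K \<le> dist (y i) (y j)" if "i < j" for i j
  proof -
    have "\<mu> (Suc i) ^ (2 ^ j) = 1"
      using \<mu>_power_mod[of "Suc i" j "2 ^ j"] that by simp
    then have "\<psi> (Suc i) (y i - y j) = - 2"
      by (simp add: clinear_functionalD(5)[OF \<psi>] \<psi>y \<mu>_half_period)
    then have "2 \<le> 2 * K * norm (y i - y j)"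
      using clinear_functionalD(3)[OF \<psi>, of "Suc i" "y i - y j"] by simp
    then show ?thesis
      using K by (simp add: dist_norm field_simps)
  qed
  have "\<not> relatively_compact (range (\<lambda>n. (mult_op \<mu> ^^ n) x))"
  proof
    assume "relatively_compact (range (\<lambda>n. (mult_op \<mu> ^^ n) x))"
    moreover have "1 / (2 * K) > 0"
      using K by simp
    ultimately obtain I where I: "finite I"
      "\<And>n. \<exists>m\<in>I. dist ((mult_op \<mu> ^^ m) x) ((mult_op \<mu> ^^ n) x) < 1 / (2 * K)"
      unfolding relatively_compact_range_iff by blast
    have "\<forall>j. \<exists>m. m \<in> I \<and> dist ((mult_op \<mu> ^^ m) x) (y j) < 1 / (2 * K)"
      using I(2) unfolding y_def by blast
    then obtain m where m: "\<And>j. m j \<in> I" "\<And>j. dist ((mult_op \<mu> ^^ m j) x) (y j) < 1 / (2 * K)"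
      by metis
    have "\<not> inj m"
      using I(1) m(1) finite_imageD[of m UNIV] finite_subset[of "range m" I] by auto
    then obtain i j where "i < j" "m i = m j"
      unfolding inj_def by (metis linorder_neqE_nat)
    then show False
      using sep[of i j] dist_triangle2[of "y i" "y j" "(mult_op \<mu> ^^ m i) x"] m(2)[of i] m(2)[of j]
      by (simp add: dist_commute)
  qed
  then show ?thesis
    by blast
qed

end

text \<open>
  The coordinates of the inverse isomorphism are bounded functionals on the copy, with a common
  bound, and are extended to the whole space.
\<close>

lemma biorthogonal_c0_of_contains_copy:
  assumes "contains_copy_of_c0 TYPE('a::{complex_normed_vector, banach})"
  obtains \<phi> :: "nat \<Rightarrow> 'a::{complex_normed_vector, banach} \<Rightarrow> complex" and g K C where "biorthogonal_c0 \<phi> g K C"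
proof -
  obtain F :: "'a set" and f g where F: "complex_vector.subspace F"
    and hom: "homeomorphism F c0 f g"
    and f_add: "\<And>x y. x \<in> F \<Longrightarrow> y \<in> F \<Longrightarrow> f (x + y) = f x + f y"
    and f_sc: "\<And>a x. x \<in> F \<Longrightarrow> f (a *\<^sub>C x) = a *\<^sub>C f x"
    using assms unfolding contains_copy_of_c0_def linearly_homeomorphic_def by blast
  have f: "f x \<in> c0" "g (f x) = x" if "x \<in> F" for x
    using hom that by (auto simp: homeomorphism_def)
  have g: "g u \<in> F" "f (g u) = u" if "u \<in> c0" for u
    using hom that by (auto simp: homeomorphism_def)
  have cont: "continuous_on F f" "continuous_on c0 g"
    using hom by (auto simp: homeomorphism_def)
  have g_add: "g (u + v) = g u + g v" if "u \<in> c0" "v \<in> c0" for u v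
    using f(2)[of "g u + g v"] g f_add[of "g u" "g v"] that complex_vector.subspace_add[OF F] by simp
  have g_sc: "g (a *\<^sub>C u) = a *\<^sub>C g u" if "u \<in> c0" for a u
    using f(2)[of "a *\<^sub>C g u"] g f_sc[of "g u" a] that complex_vector.subspace_scale[OF F] by simp
  obtain K where K: "K > 0" "\<And>x. x \<in> F \<Longrightarrow> norm (f x) \<le> K * norm x"
    using bounded_of_continuous_on_subspace[OF F cont(1) f_sc] by blast
  obtain C where C: "C > 0" "\<And>u. u \<in> c0 \<Longrightarrow> norm (g u) \<le> C * norm u"
    using bounded_of_continuous_on_subspace[OF subspace_c0 cont(2) g_sc] by blast
  have "\<exists>\<phi>. clinear_functional K \<phi> \<and> (\<forall>x\<in>F. \<phi> x = f x k)" for k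
  proof -
    have "cmod (f x k) \<le> K * norm x" if "x \<in> F" for x
      using norm_bounded[of "f x" k] K(2)[OF that] by linarith
    then obtain \<phi> where "clinear_functional K \<phi>" "\<And>x. x \<in> F \<Longrightarrow> \<phi> x = f x k"
      using hahn_banach_complex[OF F, of "\<lambda>x. f x k" K] K(1)
      by (auto simp: f_add f_sc plus_bcontfun.rep_eq apply_bcontfun_scaleC scaleC_complex_def)
    then show ?thesis
      by blast
  qed
  then obtain \<phi> where \<phi>: "\<And>k. clinear_functional K (\<phi> k)" "\<And>k x. x \<in> F \<Longrightarrow> \<phi> k x = f x k"
    by metis
  have "biorthogonal_c0 \<phi> g K C"
    using \<phi> K(1) C g g_add g_sc by unfold_locales auto
  then show ?thesis
    by (rule that)
qed

section \<open>The characterisation\<close>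

theorem theoremB:
  assumes "separable_space (euclidean :: 'a::{complex_normed_vector, banach} topology)"
  shows "\<not> contains_copy_of_c0 TYPE('a) \<longleftrightarrow>
    (\<forall>T :: 'a \<Rightarrow> 'a.
       doubly_power_bounded T \<and>
       (\<forall>x. relatively_compact (range (\<lambda>n. (T ^^ (n + 1)) x - (T ^^ n) x)))
       \<longrightarrow> almost_periodic T)"
proof
  assume no_copy: "\<not> contains_copy_of_c0 TYPE('a)"
  show "\<forall>T :: 'a \<Rightarrow> 'a. doubly_power_bounded T \<and>
      (\<forall>x. relatively_compact (range (\<lambda>n. (T ^^ (n + 1)) x - (T ^^ n) x))) \<longrightarrow> almost_periodic T"
  proof (intro allI impI)
    fix T :: "'a \<Rightarrow> 'a"
    assume T: "doubly_power_bounded T \<and>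
      (\<forall>x. relatively_compact (range (\<lambda>n. (T ^^ (n + 1)) x - (T ^^ n) x)))"
    then have lin: "bounded_linear (T ^^ n)" for n
      by (intro bounded_clinear_funpow) (simp add: doubly_power_bounded_def power_bounded_def)
    obtain M where M: "M > 0" "\<And>n x. norm ((T ^^ n) x) \<le> M * norm x"
      "\<And>n x. norm x \<le> M * norm ((T ^^ n) x)"
      using doubly_power_bounded_bounds[of T] T by blast
    show "almost_periodic T"
      unfolding almost_periodic_def
      using contains_copy_of_c0_of_noncompact_orbit[OF lin M] T no_copy by blast
  qed
next
  assume ap: "\<forall>T :: 'a \<Rightarrow> 'a. doubly_power_bounded T \<and>
      (\<forall>x. relatively_compact (range (\<lambda>n. (T ^^ (n + 1)) x - (T ^^ n) x))) \<longrightarrow> almost_periodic T"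
  show "\<not> contains_copy_of_c0 TYPE('a)"
  proof
    assume "contains_copy_of_c0 TYPE('a)"
    then obtain \<phi> :: "nat \<Rightarrow> 'a \<Rightarrow> complex" and g K C where "biorthogonal_c0 \<phi> g K C"
      by (rule biorthogonal_c0_of_contains_copy)
    then interpret biorthogonal_c0 \<phi> g K C .
    have "almost_periodic (mult_op \<mu>)"
      using ap doubly_power_bounded_mult_op[OF multiplier_\<mu> cmod_\<mu>] relatively_compact_differences by blast
    then show False
      using not_relatively_compact_orbit by (auto simp: almost_periodic_def)
  qed
qed

end
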